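(* Let $\Lambda_{\mathcal F}(p)$ be the coin tossing integer self-similar set on the line with IFS $\mathcal F$ and parameter $p\in(0,1)$. Suppose that the following two conditions hold: (1) $p^L\cdot\prod_{a=0}^{L-1}CS_{a,U}>1$ for all $U\in[N]$; (2) for every $b\in[L]$ there exists a $U\in[N]$ such that $A_b(U,V)>0$ for all $V\in[N]$. Then $\Lambda_{\mathcal F}(p)$ has positive Lebesgue measure almost surely conditioned on non-extinction.
   Context: Notation: $[k]:=\{0,1,\dots,k-1\}$. IFS: $\mathcal F=\{f_i(x)=\frac1L x+t_i\}_{i=0}^{M-1}$ on $\mathbb R$, where $L\in\mathbb N$, $L\ge2$, $t_i\in\mathbb N$ ($0\in\mathbb N$), $0=t_0\le t_1\le\dots\le t_{M-1}$, and $L-1$ divides $t_{M-1}$. Repetitions among the $f_i$ are allowed. Write $f_{i_1\dots i_n}=f_{i_1}\circ\dots\circ f_{i_n}$. Coin tossing self-similar set: give each nonempty finite word $\mathbf i$ over $[M]$ an independent Bernoulli($p$) label. Let $\mathcal E_n\subset[M]^n$ be the random set of words $i_1\dots i_n$ such that all of the words $i_1,\ i_1i_2,\dots,\ i_1\dots i_n$ have label $1$. With $I=[0,\frac{L\,t_{M-1}}{L-1}]$ (so $f_i(I)\subset I$ for all $i$), $\Lambda_{\mathcal F}(p):=\bigcap_{n\ge1}\bigcup_{\mathbf i\in\mathcal E_n}f_{\mathbf i}(I)$. Non-extinction is the event that $\mathcal E_n\ne\emptyset$ for all $n$; a property holds "almost surely conditioned on non-extinction" if the event that non-extinction occurs and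 the property fails has probability $0$. Distinct maps: let $\mathcal S=\{S_j(x)=\frac1Lx+t_j'\}_{j=0}^{m-1}$ be the distinct elements of $\mathcal F$ and $n_j=\#\{i\in[M]:f_i=S_j\}$. Let $\nu$ be the self-similar probability measure of $\mathcal S$ with weights $q_j=n_j/M$, i.e. the push-forward of the product measure $(q_0,\dots,q_{m-1})^{\mathbb N}$ under $i_1i_2\dots\mapsto\lim_n S_{i_1}\circ\dots\circ S_{i_n}(0)$. Basic types: $J^0,\dots,J^{N-1}$ are the finitely many intervals of the form $[(i-1)L,iL]$, $i\in\mathbb Z$, having positive $\nu$-measure, in increasing order (they cover the support of $\nu$). If $J^k=[uL,(u+1)L]$ and $a\in[L]$, then $J^k_a=[uL+a,\,uL+a+1]$. Matrices: for $a\in[L]$, $A_a$ is the $N\times N$ matrix, with rows and columns indexed by $[N]$, given by $A_a(\ell,k)=n_i$ if there is an $i\in[m]$ with $S_i(J^k)=J^\ell_a$ (such $i$ is unique), and $A_a(\ell,k)=0$ otherwise. Column sums: $CS_{a,j}=\sum_{i=0}^{N-1}A_a(i,j)$. *)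

theory Defs
  imports "HOL-Probability.Probability"
begin

text \<open>
  The IFS is given by its data \<open>L\<close>, \<open>M\<close> and \<open>t 0, \<dots>, t (M - 1)\<close>. The index set
  \<open>[k] = {0, \<dots>, k - 1}\<close> is rendered as \<open>{..<k}\<close>; values of indexed families outside their index
  set are irrelevant.
\<close>

definition integer_ifs :: "nat \<Rightarrow> nat \<Rightarrow> (nat \<Rightarrow> nat) \<Rightarrow> bool" where
  "integer_ifs L M t \<longleftrightarrow>
     2 \<le> L \<and> 1 \<le> M \<and> t 0 = 0 \<and> (\<forall>i j. i \<le> j \<and> j < M \<longrightarrow> t i \<le> t j) \<and> (L - 1) dvd t (M - 1)"

definition ifs_map :: "nat \<Rightarrow> (nat \<Rightarrow> nat) \<Rightarrow> nat \<Rightarrow> real \<Rightarrow> real" where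
  "ifs_map L t i x = x / real L + real (t i)"

fun word_map :: "nat \<Rightarrow> (nat \<Rightarrow> nat) \<Rightarrow> nat list \<Rightarrow> real \<Rightarrow> real" where
  "word_map L t [] = id"
| "word_map L t (i # w) = ifs_map L t i \<circ> word_map L t w"


subsection \<open>The coin tossing self-similar set\<close>

definition nonempty_words :: "nat \<Rightarrow> nat list set" where
  "nonempty_words M = {w. w \<noteq> [] \<and> set w \<subseteq> {..<M}}"

text \<open>\<open>X w \<omega>\<close> says that, in the outcome \<open>\<omega>\<close>, the word \<open>w\<close> has label 1.\<close>

definition surviving_words :: "nat \<Rightarrow> (nat list \<Rightarrow> 'w \<Rightarrow> bool) \<Rightarrow> nat \<Rightarrow> 'w \<Rightarrow> nat list set" where
  "surviving_words M X n \<omega> =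
     {w. length w = n \<and> set w \<subseteq> {..<M} \<and> (\<forall>k\<in>{1..n}. X (take k w) \<omega>)}"

definition non_extinct :: "nat \<Rightarrow> (nat list \<Rightarrow> 'w \<Rightarrow> bool) \<Rightarrow> 'w \<Rightarrow> bool" where
  "non_extinct M X \<omega> \<longleftrightarrow> (\<forall>n\<ge>1. surviving_words M X n \<omega> \<noteq> {})"

definition base_interval :: "nat \<Rightarrow> nat \<Rightarrow> (nat \<Rightarrow> nat) \<Rightarrow> real set" where
  "base_interval L M t = {0 .. real L * real (t (M - 1)) / (real L - 1)}"

definition coin_tossing_set ::
    "nat \<Rightarrow> nat \<Rightarrow> (nat \<Rightarrow> nat) \<Rightarrow> (nat list \<Rightarrow> 'w \<Rightarrow> bool) \<Rightarrow> 'w \<Rightarrow> real set" where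
  "coin_tossing_set L M t X \<omega> =
     (\<Inter>n\<in>{1..}. \<Union>w\<in>surviving_words M X n \<omega>. word_map L t w ` base_interval L M t)"


subsection \<open>The distinct maps and the self-similar measure\<close>

text \<open>
  All maps have the same contraction ratio, so distinct maps correspond to distinct translations.
  We enumerate them by increasing translation: \<open>S\<^sub>j\<close> is \<open>ifs_map L (distinct_trans M t) j\<close>
  for \<open>j < num_distinct M t\<close>.
\<close>

definition num_distinct :: "nat \<Rightarrow> (nat \<Rightarrow> nat) \<Rightarrow> nat" where
  "num_distinct M t = card (t ` {..<M})"

definition distinct_trans :: "nat \<Rightarrow> (nat \<Rightarrow> nat) \<Rightarrow> nat \<Rightarrow> nat" where
  "distinct_trans M t j = sorted_list_of_set (t ` {..<M}) ! j"

definition map_mult :: "nat \<Rightarrow> nat \<Rightarrow> (nat \<Rightarrow> nat) \<Rightarrow> nat \<Rightarrow> nat" where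
  "map_mult L M t j = card {i. i < M \<and> ifs_map L t i = ifs_map L (distinct_trans M t) j}"

definition symbolic_measure :: "nat \<Rightarrow> nat \<Rightarrow> (nat \<Rightarrow> nat) \<Rightarrow> (nat \<Rightarrow> nat) measure" where
  "symbolic_measure L M t =
     PiM UNIV (\<lambda>_. point_measure {..<num_distinct M t}
                     (\<lambda>j. ennreal (real (map_mult L M t j) / real M)))"

definition coding_map :: "nat \<Rightarrow> nat \<Rightarrow> (nat \<Rightarrow> nat) \<Rightarrow> (nat \<Rightarrow> nat) \<Rightarrow> real" where
  "coding_map L M t s = lim (\<lambda>n. word_map L (distinct_trans M t) (map s [0..<n]) 0)"

definition self_similar_measure :: "nat \<Rightarrow> nat \<Rightarrow> (nat \<Rightarrow> nat) \<Rightarrow> real measure" where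
  "self_similar_measure L M t = distr (symbolic_measure L M t) borel (coding_map L M t)"


subsection \<open>Basic types and matrices\<close>

text \<open>\<open>basic_positions L M t\<close> is the finite set of those integers \<open>u\<close> for which \<open>[u L, (u + 1) L]\<close>
  has positive measure.\<close>

definition basic_positions :: "nat \<Rightarrow> nat \<Rightarrow> (nat \<Rightarrow> nat) \<Rightarrow> int set" where
  "basic_positions L M t =
     {u. 0 < emeasure (self_similar_measure L M t)
               {of_int u * real L .. (of_int u + 1) * real L}}"

definition num_types :: "nat \<Rightarrow> nat \<Rightarrow> (nat \<Rightarrow> nat) \<Rightarrow> nat" where
  "num_types L M t = card (basic_positions L M t)"

definition type_position :: "nat \<Rightarrow> nat \<Rightarrow> (nat \<Rightarrow> nat) \<Rightarrow> nat \<Rightarrow> int" where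
  "type_position L M t k = sorted_list_of_set (basic_positions L M t) ! k"

definition basic_type :: "nat \<Rightarrow> nat \<Rightarrow> (nat \<Rightarrow> nat) \<Rightarrow> nat \<Rightarrow> real set" where
  "basic_type L M t k =
     (let u = real_of_int (type_position L M t k) in {u * real L .. (u + 1) * real L})"

definition basic_subtype :: "nat \<Rightarrow> nat \<Rightarrow> (nat \<Rightarrow> nat) \<Rightarrow> nat \<Rightarrow> nat \<Rightarrow> real set" where
  "basic_subtype L M t k a =
     (let u = real_of_int (type_position L M t k)
      in {u * real L + real a .. u * real L + real a + 1})"

definition type_matrix :: "nat \<Rightarrow> nat \<Rightarrow> (nat \<Rightarrow> nat) \<Rightarrow> nat \<Rightarrow> nat \<Rightarrow> nat \<Rightarrow> nat" where
  "type_matrix L M t a l k =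
     (let Q = (\<lambda>i. i < num_distinct M t \<and>
                 ifs_map L (distinct_trans M t) i ` basic_type L M t k = basic_subtype L M t l a)
      in if (\<exists>i. Q i) then map_mult L M t (THE i. Q i) else 0)"

definition column_sum :: "nat \<Rightarrow> nat \<Rightarrow> (nat \<Rightarrow> nat) \<Rightarrow> nat \<Rightarrow> nat \<Rightarrow> nat" where
  "column_sum L M t a j = (\<Sum>i<num_types L M t. type_matrix L M t a i j)"

end

theory Submission
  imports Defs
begin

text \<open>
  Fix a point \<open>x\<close> and let \<open>s\<^sub>n\<close> be the vector, indexed by the basic types, of the probabilities
  that a line of descent covering \<open>x\<close> survives \<open>n\<close> generations. When a digit \<open>a\<close> is prepended
  to the expansion of \<open>x\<close>, \<open>s\<^sub>n\<close> is mapped to a vector whose \<open>l\<close>-th entry is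
  \<open>1 - \<Prod>k. (1 - p s\<^sub>n(k))^A\<^sub>a(l,k)\<close>, which is \<open>p A\<^sub>a s\<^sub>n\<close> up to a quadratic error. Let \<open>W\<close> be the sum
  of the entries. Concavity of the logarithm and the condition on the column sums show that, on
  average over \<open>a\<close>, \<open>ln W\<close> increases by a fixed amount as long as \<open>W\<close> is small. Since \<open>ln W\<close> is
  bounded above and the mean of \<open>W\<close> decreases with \<open>n\<close>, this mean stays bounded away from 0, and
  by Fubini the limit set has positive measure with positive probability. The probability \<open>r\<close> of
  this event and the survival probability both solve \<open>1 - r = (1 - p r)^M\<close>, which has only one
  root in \<open>(0, 1]\<close>; hence they agree.
\<close>

subsection \<open>The space of labels and the branching property\<close>

text \<open>The canonical model of the labels. A general label family enters only through its joint
  law, see \<open>distr_labels\<close>.\<close>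

definition coin_space :: "nat \<Rightarrow> real \<Rightarrow> (nat list \<Rightarrow> bool) measure" where
  "coin_space M p = PiM (nonempty_words M) (\<lambda>_. measure_pmf (bernoulli_pmf p))"

text \<open>The labels seen from the node \<open>i\<close>, without the label of \<open>i\<close>
  itself since \<open>w\<close> is nonempty. The restriction makes the result extensional, hence a
  point of the product space.\<close>

definition subtree :: "nat \<Rightarrow> nat \<Rightarrow> (nat list \<Rightarrow> bool) \<Rightarrow> nat list \<Rightarrow> bool" where
  "subtree M i x = (\<lambda>w\<in>nonempty_words M. x (i # w))"

lemma Cons_nonempty_words: "i < M \<Longrightarrow> w = [] \<or> w \<in> nonempty_words M \<Longrightarrow> i # w \<in> nonempty_words M"
  by (auto simp: nonempty_words_def)

lemma prob_space_coin_space: "prob_space (coin_space M p)"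
  unfolding coin_space_def by (intro prob_space_PiM prob_space_measure_pmf)

lemma space_coin_space: "space (coin_space M p) = extensional (nonempty_words M)"
  by (simp add: coin_space_def space_PiM PiE_def Pi_def)

lemma coordinate_measurable [measurable]:
  "w \<in> nonempty_words M \<Longrightarrow> (\<lambda>x. x w) \<in> measurable (coin_space M p) (count_space UNIV)"
proof -
  assume "w \<in> nonempty_words M"
  then have "(\<lambda>x. x w) \<in> measurable (coin_space M p) (measure_pmf (bernoulli_pmf p))"
    unfolding coin_space_def by (rule measurable_component_singleton)
  then show ?thesis
    by (subst measurable_cong_sets[OF refl, of _ "measure_pmf (bernoulli_pmf p)"]) auto
qed

text \<open>Prepending a letter is injective, and an injective reindexing of an i.i.d. family
  preserves its law.\<close>

lemma distr_subtree:
  assumes "i < M"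
  shows "distr (coin_space M p) (coin_space M p) (subtree M i) = coin_space M p"
  using distr_PiM_reindex[of "nonempty_words M" "\<lambda>_. measure_pmf (bernoulli_pmf p)"
      "(#) i" "nonempty_words M"] assms
  by (auto simp: coin_space_def subtree_def[abs_def] prob_space_measure_pmf Cons_nonempty_words)

lemma subtree_measurable [measurable]:
  "i < M \<Longrightarrow> subtree M i \<in> measurable (coin_space M p) (coin_space M p)"
  unfolding coin_space_def subtree_def[abs_def]
  by (intro measurable_restrict measurable_component_singleton) (auto simp: Cons_nonempty_words)

lemma coordinates_indep:
  assumes "1 \<le> M"
  shows "prob_space.indep_vars (coin_space M p) (\<lambda>_. measure_pmf (bernoulli_pmf p))
           (\<lambda>w x. x w) (nonempty_words M)"
proof -
  interpret prob_space "coin_space M p" by (rule prob_space_coin_space)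
  have ne: "nonempty_words M \<noteq> {}"
    using assms by (auto simp: nonempty_words_def intro!: exI[of _ "[0]"])
  have rv: "(\<lambda>x. x w) \<in> measurable (coin_space M p) (measure_pmf (bernoulli_pmf p))"
    if "w \<in> nonempty_words M" for w
    using that unfolding coin_space_def by (rule measurable_component_singleton)
  have 1: "distr (coin_space M p) (measure_pmf (bernoulli_pmf p)) (\<lambda>x. x w)
      = measure_pmf (bernoulli_pmf p)" if "w \<in> nonempty_words M" for w
    unfolding coin_space_def
    by (rule distr_PiM_component[OF _ that]) (auto intro: prob_space_measure_pmf)
  have "distr (coin_space M p) (coin_space M p) (\<lambda>x. \<lambda>w\<in>nonempty_words M. x w)
      = distr (coin_space M p) (coin_space M p) (\<lambda>x. x)"
    by (rule distr_cong) (auto simp: space_coin_space extensional_restrict)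
  then show ?thesis
    by (subst indep_vars_iff_distr_eq_PiM'[OF ne rv])
      (auto simp: 1 coin_space_def[symmetric] distr_id cong: PiM_cong)
qed

text \<open>The root label and the subtree read disjoint sets of coordinates, so they are
  independent, and the subtree has the law of the whole tree.\<close>

lemma measure_root_subtree:
  assumes i: "i < M" and p: "0 \<le> p" "p \<le> 1" and A: "A \<in> sets (coin_space M p)"
  shows "measure (coin_space M p) {x \<in> space (coin_space M p). x [i] \<and> subtree M i x \<in> A}
           = p * measure (coin_space M p) A"
proof -
  let ?B = "\<lambda>_::nat list. measure_pmf (bernoulli_pmf p)"
  interpret prob_space "coin_space M p" by (rule prob_space_coin_space)
  let ?K = "(#) i ` nonempty_words M"
  have iw: "[i] \<in> nonempty_words M" using i by (simp add: Cons_nonempty_words)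
  have ind: "indep_var (PiM {[i]} ?B) (\<lambda>x. restrict (\<lambda>w. x w) {[i]})
      (PiM ?K ?B) (\<lambda>x. restrict (\<lambda>w. x w) ?K)"
    using i by (intro indep_var_restrict[OF coordinates_indep])
      (auto simp: nonempty_words_def)
  have m1: "(\<lambda>y. y [i]) \<in> measurable (PiM {[i]} ?B) (measure_pmf (bernoulli_pmf p))"
    by (rule measurable_component_singleton) simp
  have m2: "subtree M i \<in> measurable (PiM ?K ?B) (coin_space M p)"
    unfolding coin_space_def subtree_def[abs_def]
    by (intro measurable_restrict measurable_component_singleton) auto
  define B1 where "B1 = {y \<in> space (PiM {[i]} ?B). y [i]}"
  define B2 where "B2 = subtree M i -` A \<inter> space (PiM ?K ?B)"
  have "Measurable.pred (PiM {[i]} ?B) (\<lambda>y. y [i])"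
    by (rule measurable_compose[OF m1]) simp
  then have B1: "B1 \<in> sets (PiM {[i]} ?B)" unfolding B1_def by measurable
  have B2: "B2 \<in> sets (PiM ?K ?B)"
    unfolding B2_def by (rule measurable_sets[OF m2 A])
  have r: "subtree M i (restrict x ?K) = subtree M i x" for x
    by (auto simp: subtree_def fun_eq_iff)
  have "prob ((\<lambda>x. (restrict x {[i]}, restrict x ?K)) -` (B1 \<times> B2) \<inter> space (coin_space M p)) =
      prob ((\<lambda>x. restrict x {[i]}) -` B1 \<inter> space (coin_space M p)) *
      prob ((\<lambda>x. restrict x ?K) -` B2 \<inter> space (coin_space M p))"
    by (rule indep_varD[OF ind B1 B2])
  also have "(\<lambda>x. (restrict x {[i]}, restrict x ?K)) -` (B1 \<times> B2) \<inter> space (coin_space M p)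
      = {x \<in> space (coin_space M p). x [i] \<and> subtree M i x \<in> A}"
    by (auto simp: B1_def B2_def r space_PiM)
  also have "(\<lambda>x. restrict x {[i]}) -` B1 \<inter> space (coin_space M p)
      = (\<lambda>x. x [i]) -` {True} \<inter> space (coin_space M p)"
    by (auto simp: B1_def space_PiM)
  also have "(\<lambda>x. restrict x ?K) -` B2 \<inter> space (coin_space M p)
      = subtree M i -` A \<inter> space (coin_space M p)"
    by (auto simp: B2_def r space_PiM)
  also have "prob (subtree M i -` A \<inter> space (coin_space M p)) = prob A"
    using measure_distr[OF subtree_measurable[OF i] A] distr_subtree[OF i, of p] by simp
  also have "prob ((\<lambda>x. x [i]) -` {True} \<inter> space (coin_space M p)) = p"
  proof -
    have "distr (coin_space M p) (measure_pmf (bernoulli_pmf p)) (\<lambda>x. x [i])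
      = measure_pmf (bernoulli_pmf p)"
      unfolding coin_space_def
      by (rule distr_PiM_component[OF _ iw]) (auto intro: prob_space_measure_pmf)
    moreover have "(\<lambda>x. x [i]) \<in> measurable (coin_space M p) (measure_pmf (bernoulli_pmf p))"
      unfolding coin_space_def by (rule measurable_component_singleton[OF iw])
    ultimately have "prob ((\<lambda>x. x [i]) -` {True} \<inter> space (coin_space M p))
        = measure (measure_pmf (bernoulli_pmf p)) {True}"
      by (metis measure_distr UNIV_I sets_measure_pmf)
    then show ?thesis using p by (simp add: measure_pmf_single)
  qed
  finally show ?thesis .
qed

text \<open>In the complement every child fails, and the \<open>M\<close> failures read disjoint
  sets of words. This identity yields the recursion for covering probabilities as well as the
  fixed-point equations for survival and for positive measure.\<close>

lemma measure_branching:
  assumes p: "0 \<le> p" "p \<le> 1" and A: "\<And>i. i < M \<Longrightarrow> A i \<in> sets (coin_space M p)"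
  shows "measure (coin_space M p)
             {x \<in> space (coin_space M p). \<exists>i<M. x [i] \<and> subtree M i x \<in> A i}
           = 1 - (\<Prod>i<M. 1 - p * measure (coin_space M p) (A i))"
proof (cases "M = 0")
  case True
  then show ?thesis by simp
next
  case False
  let ?B = "\<lambda>_::nat list. measure_pmf (bernoulli_pmf p)"
  interpret prob_space "coin_space M p" by (rule prob_space_coin_space)
  let ?S = "space (coin_space M p)"
  \<comment> \<open>Words are grouped by their first letter; \<open>F i\<close> is the failure of
    child \<open>i\<close> as an event on its own block, \<open>G i\<close> its success on the whole
    space.\<close>
  define K where "K i = {w \<in> nonempty_words M. hd w = i}" for i
  define F where "F i = {y \<in> space (PiM (K i) ?B). \<not> (y [i] \<and> subtree M i y \<in> A i)}" for i
  define G where "G i = {x \<in> ?S. x [i] \<and> subtree M i x \<in> A i}" for i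
  have ind: "indep_vars (\<lambda>i. PiM (K i) ?B) (\<lambda>i x. restrict (\<lambda>w. x w) (K i)) {..<M}"
    using False by (intro indep_vars_restrict[OF coordinates_indep])
      (auto simp: K_def disjoint_family_on_def)
  have F: "F i \<in> sets (PiM (K i) ?B)" if i: "i < M" for i
  proof -
    have m1: "(\<lambda>y. y [i]) \<in> measurable (PiM (K i) ?B) (measure_pmf (bernoulli_pmf p))"
      by (rule measurable_component_singleton) (use i in \<open>auto simp: K_def nonempty_words_def\<close>)
    have m1': "(\<lambda>y. y [i]) \<in> measurable (PiM (K i) ?B) (count_space UNIV)"
      by (rule measurable_compose[OF m1]) simp
    have m2: "subtree M i \<in> measurable (PiM (K i) ?B) (coin_space M p)"
      unfolding coin_space_def subtree_def[abs_def]
      by (intro measurable_restrict measurable_component_singleton)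
        (use i in \<open>auto simp: K_def nonempty_words_def\<close>)
    note [measurable] = m1' m2 A[OF i]
    show ?thesis unfolding F_def by measurable
  qed
  have pre: "(\<lambda>x. restrict (\<lambda>w. x w) (K i)) -` F i \<inter> ?S = ?S - G i" if i: "i < M" for i
  proof -
    have "subtree M i (restrict x (K i)) = subtree M i x" for x
      using i by (auto simp: subtree_def fun_eq_iff K_def nonempty_words_def)
    moreover have "[i] \<in> K i" using i by (auto simp: K_def nonempty_words_def)
    ultimately show ?thesis
      by (auto simp: F_def G_def space_PiM PiE_def Pi_def)
  qed
  have G: "G i \<in> events" if i: "i < M" for i
  proof -
    have [measurable]: "[i] \<in> nonempty_words M" using i by (simp add: Cons_nonempty_words)
    note [measurable] = A[OF i] subtree_measurable[OF i]
    show ?thesis unfolding G_def by measurable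
  qed
  have "prob (\<Inter>i\<in>{..<M}. (\<lambda>x. restrict (\<lambda>w. x w) (K i)) -` F i \<inter> ?S)
      = (\<Prod>i<M. prob ((\<lambda>x. restrict (\<lambda>w. x w) (K i)) -` F i \<inter> ?S))"
    by (rule indep_varsD[OF ind]) (use False F in auto)
  also have "\<dots> = (\<Prod>i<M. 1 - p * prob (A i))"
  proof (rule prod.cong)
    fix i assume "i \<in> {..<M}"
    then have i: "i < M" by simp
    show "prob ((\<lambda>x. restrict (\<lambda>w. x w) (K i)) -` F i \<inter> ?S) = 1 - p * prob (A i)"
      using pre[OF i] prob_compl[OF G[OF i]] measure_root_subtree[OF i p A[OF i]]
      by (simp add: G_def)
  qed simp
  also have "(\<Inter>i\<in>{..<M}. (\<lambda>x. restrict (\<lambda>w. x w) (K i)) -` F i \<inter> ?S) = ?S - (\<Union>i<M. G i)"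
    using pre False by auto
  also have "prob (?S - (\<Union>i<M. G i)) = 1 - prob (\<Union>i<M. G i)"
    by (rule prob_compl) (use G in auto)
  also have "(\<Union>i<M. G i) = {x \<in> ?S. \<exists>i<M. x [i] \<and> subtree M i x \<in> A i}"
    by (auto simp: G_def)
  finally show ?thesis by simp
qed

subsection \<open>Survival probabilities along digit expansions\<close>

lemma one_minus_prod_ge:
  fixes x :: "'i \<Rightarrow> real"
  assumes "finite I" "\<And>i. i \<in> I \<Longrightarrow> 0 \<le> x i \<and> x i \<le> 1"
  shows "1 - (\<Prod>i\<in>I. 1 - x i) \<ge> (\<Sum>i\<in>I. x i) - (\<Sum>i\<in>I. x i)\<^sup>2"
proof -
  \<comment> \<open>Both bounds are carried through the induction, because the upper bound for the
    larger product uses the lower bound for the smaller one.\<close>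
  have "(\<Prod>i\<in>I. 1 - x i) \<ge> 1 - (\<Sum>i\<in>I. x i) \<and>
        (\<Prod>i\<in>I. 1 - x i) \<le> 1 - (\<Sum>i\<in>I. x i) + (\<Sum>i\<in>I. x i)\<^sup>2"
    using assms
  proof (induction I)
    case empty
    then show ?case by simp
  next
    case (insert j I)
    let ?S = "\<Sum>i\<in>I. x i" and ?P = "\<Prod>i\<in>I. 1 - x i"
    have j: "0 \<le> x j" "x j \<le> 1" using insert.prems by auto
    have S: "0 \<le> ?S" using insert.prems by (auto intro: sum_nonneg)
    have IH: "?P \<ge> 1 - ?S" "?P \<le> 1 - ?S + ?S\<^sup>2" using insert by auto
    have P1: "?P \<le> 1" using insert.prems by (intro prod_le_1) auto
    have "x j * ?P \<le> x j * 1" by (rule mult_left_mono[OF P1 j(1)])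
    moreover have "x j * (1 - ?S) \<le> x j * ?P" by (rule mult_left_mono[OF IH(1) j(1)])
    moreover have "0 \<le> x j * ?S" using j S by simp
    moreover have "0 \<le> x j * x j" by simp
    moreover have "(1 - x j) * ?P = ?P - x j * ?P" "x j * (1 - ?S) = x j - x j * ?S"
      "(x j + ?S)\<^sup>2 = x j * x j + 2 * (x j * ?S) + ?S\<^sup>2"
      by (simp_all add: power2_eq_square algebra_simps)
    ultimately have "1 - (x j + ?S) \<le> (1 - x j) * ?P"
      "(1 - x j) * ?P \<le> 1 - (x j + ?S) + (x j + ?S)\<^sup>2"
      using IH by linarith+
    then show ?case using insert.hyps by simp
  qed
  then show ?thesis by simp
qed

text \<open>Concavity of \<open>ln\<close> after normalising the weights; the factor taken out
  produces \<open>ln (sum w I)\<close>.\<close>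

lemma Jensen_ln:
  fixes w c :: "'i \<Rightarrow> real"
  assumes "finite I" "\<And>i. i \<in> I \<Longrightarrow> 0 \<le> w i" "\<And>i. i \<in> I \<Longrightarrow> 0 < c i" "0 < sum w I"
  shows "ln (\<Sum>i\<in>I. w i * c i) \<ge> ln (sum w I) + (\<Sum>i\<in>I. (w i / sum w I) * ln (c i))"
proof -
  let ?s = "sum w I"
  have "(\<Sum>i\<in>I. w i / ?s) = 1"
    using assms(4) by (simp add: sum_divide_distrib[symmetric])
  then have "ln (\<Sum>i\<in>I. (w i / ?s) *\<^sub>R c i) \<ge> (\<Sum>i\<in>I. (w i / ?s) * ln (c i))"
    using assms by (intro concave_on_sum[OF assms(1) _ ln_concave]) auto
  moreover have "(\<Sum>i\<in>I. w i * c i) = ?s * (\<Sum>i\<in>I. (w i / ?s) *\<^sub>R c i)"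
    using assms(4) by (simp add: sum_distrib_left)
  moreover have "0 < (\<Sum>i\<in>I. w i * c i)"
  proof -
    obtain j where "j \<in> I" "w j > 0"
      using assms(4) by (meson not_less sum_nonpos)
    then show ?thesis using assms by (intro sum_pos2[of _ j]) (auto simp: less_imp_le)
  qed
  ultimately show ?thesis
    using assms(4) by (simp add: ln_mult zero_less_mult_iff)
qed

section \<open>The uniform law on the unit interval and base-\<open>L\<close> digits\<close>

definition unit_uniform :: "real measure" where
  "unit_uniform = restrict_space lborel {0..<1}"

lemma space_unit_uniform [simp]: "space unit_uniform = {0..<1}"
  by (simp add: unit_uniform_def space_restrict_space)

lemma prob_space_unit_uniform: "prob_space unit_uniform"
  by (rule prob_spaceI) (simp add: unit_uniform_def emeasure_restrict_space space_restrict_space)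

lemma measure_unit_uniform [simp]: "measure unit_uniform {0..<1} = 1"
  using prob_space.prob_space[OF prob_space_unit_uniform] by simp

lemma measurable_unit_uniform:
  "f \<in> borel_measurable borel \<Longrightarrow> f \<in> borel_measurable unit_uniform"
  unfolding unit_uniform_def by (rule measurable_restrict_space1) simp

lemma integrable_unit_uniform:
  fixes f :: "real \<Rightarrow> real"
  assumes "f \<in> borel_measurable borel" "\<And>z. 0 \<le> z \<Longrightarrow> z < 1 \<Longrightarrow> \<bar>f z\<bar> \<le> b"
  shows "integrable unit_uniform f"
proof -
  interpret prob_space unit_uniform by (rule prob_space_unit_uniform)
  show ?thesis
    by (rule integrable_const_bound[of _ b])
      (use assms measurable_unit_uniform in auto)
qed

lemma integral_unit_uniform:
  fixes f :: "real \<Rightarrow> real"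
  shows "(\<integral>z. f z \<partial>unit_uniform) = (\<integral>z. indicator {0..<1} z * f z \<partial>lborel)"
  unfolding unit_uniform_def by (subst integral_restrict_space) auto

text \<open>Conditioning on the first base-\<open>L\<close> digit \<open>a\<close>: it is uniform,
  and the rescaled remainder \<open>z\<close> is again uniform and independent of it.\<close>

lemma integral_unit_uniform_split:
  fixes f :: "real \<Rightarrow> real"
  assumes L: "0 < L" and f: "f \<in> borel_measurable borel"
    and b: "\<And>z. 0 \<le> z \<Longrightarrow> z < 1 \<Longrightarrow> \<bar>f z\<bar> \<le> b"
  shows "(\<integral>z. f z \<partial>unit_uniform)
           = (\<integral>z. (\<Sum>a<L. f ((real a + z) / real L)) / real L \<partial>unit_uniform)"
proof -
  let ?I = "\<lambda>a::nat. {real a / L..<(real a + 1) / L}"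
  have sub: "0 \<le> (real a + z) / L \<and> (real a + z) / L < 1" if "a < L" "0 \<le> z" "z < 1" for a z
    using that L by (auto simp: divide_less_eq)
  have ind: "indicator {0..<1} z = (\<Sum>a<L. indicator (?I a) z :: real)" for z :: real
  proof (cases "0 \<le> z \<and> z < 1")
    case True
    \<comment> \<open>\<open>a0\<close> is the leading digit of \<open>z\<close>, the only index
      whose interval contains \<open>z\<close>.\<close>
    define a0 where "a0 = nat \<lfloor>z * L\<rfloor>"
    have *: "z \<in> ?I a \<longleftrightarrow> a = a0" for a
    proof -
      have "z \<in> ?I a \<longleftrightarrow> real a \<le> z * L \<and> z * L < real a + 1"
        using L by (auto simp: divide_le_eq less_divide_eq mult.commute)
      also have "\<dots> \<longleftrightarrow> \<lfloor>z * L\<rfloor> = int a"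
        by (simp add: floor_eq_iff)
      also have "\<dots> \<longleftrightarrow> a = a0"
        unfolding a0_def using True L by auto
      finally show ?thesis .
    qed
    have "a0 < L"
    proof -
      have "z * real L < 1 * real L" by (rule mult_strict_right_mono) (use True L in auto)
      then have "\<lfloor>z * L\<rfloor> < int L" by (simp add: floor_less_iff)
      then show ?thesis unfolding a0_def using L by auto
    qed
    have "(\<Sum>a<L. indicator (?I a) z :: real) = (\<Sum>a<L. if a = a0 then 1 else 0)"
      by (intro sum.cong refl) (simp only: indicator_def * of_bool_def)
    with True \<open>a0 < L\<close> show ?thesis by simp
  next
    case False
    have "z \<notin> ?I a" if "a < L" for a
    proof
      assume z: "z \<in> ?I a"
      have "(real a + 1) / L \<le> 1" using that L by (simp add: divide_le_eq)
      moreover have "0 \<le> real a / L" "real a / L \<le> z" "z < (real a + 1) / L" using z by auto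
      ultimately show False using False by linarith
    qed
    then show ?thesis using False by (auto intro!: sum.neutral[symmetric])
  qed
  have int: "integrable lborel (\<lambda>z. indicator (?I a) z * f z)" if a: "a < L" for a
  proof -
    have "integrable lborel (\<lambda>z. indicator {0..<1} z * f z)"
      using integrable_unit_uniform[of f b] f b integrable_restrict_space[of "{0..<1}" lborel f]
      by (simp add: unit_uniform_def)
    then have "integrable lborel (\<lambda>z. indicator (?I a) z * (indicator {0..<1} z * f z))"
      using integrable_real_mult_indicator[of "?I a" lborel "\<lambda>z. indicator {0..<1} z * f z"]
      by (simp add: mult.commute)
    moreover have "?I a \<subseteq> {0..<1}"
    proof -
      have "(real a + 1) / L \<le> 1" using a L by (simp add: divide_le_eq)
      then show ?thesis by (auto intro: order_trans[OF _ , of _ "real a / L"])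
    qed
    then have "(\<lambda>z. indicator (?I a) z * (indicator {0..<1} z * f z))
        = (\<lambda>z. indicator (?I a) z * f z)"
      by (intro ext) (simp add: indicator_def subset_iff)
    ultimately show ?thesis by metis
  qed
  have "(\<integral>z. f z \<partial>unit_uniform) = (\<Sum>a<L. \<integral>z. indicator (?I a) z * f z \<partial>lborel)"
    unfolding integral_unit_uniform ind sum_distrib_right
    by (rule Bochner_Integration.integral_sum) (use int in auto)
  also have "\<dots> = (\<Sum>a<L. \<integral>z. f ((real a + z) / L) / L \<partial>unit_uniform)"
  proof (rule sum.cong)
    fix a assume "a \<in> {..<L}"
    have "(\<integral>z. indicator (?I a) z * f z \<partial>lborel)
        = \<bar>1 / real L\<bar> *\<^sub>R (\<integral>z. indicator (?I a) (real a / L + 1 / L * z) * f (real a / L + 1 / L * z) \<partial>lborel)"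
      by (rule lborel_integral_real_affine) (use L in auto)
    also have "\<dots> = (1 / L) * (\<integral>z. indicator {0..<1} z * f ((real a + z) / L) \<partial>lborel)"
    proof -
      have "indicator (?I a) (real a / L + 1 / L * z) = (indicator {0..<1} z :: real)"
        and "real a / L + 1 / L * z = (real a + z) / L" for z
        using L by (auto simp: indicator_def divide_simps)
      then show ?thesis by simp
    qed
    also have "\<dots> = (\<integral>z. f ((real a + z) / L) / L \<partial>unit_uniform)"
      unfolding integral_unit_uniform by simp
    finally show "(\<integral>z. indicator (?I a) z * f z \<partial>lborel)
        = (\<integral>z. f ((real a + z) / L) / L \<partial>unit_uniform)" .
  qed simp
  also have "\<dots> = (\<integral>z. (\<Sum>a<L. f ((real a + z) / L)) / L \<partial>unit_uniform)"
    unfolding sum_divide_distrib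
  proof (rule Bochner_Integration.integral_sum[symmetric])
    fix a assume a: "a \<in> {..<L}"
    show "integrable unit_uniform (\<lambda>z. f ((real a + z) / L) / L)"
    proof (rule integrable_unit_uniform)
      show "(\<lambda>z. f ((real a + z) / L) / L) \<in> borel_measurable borel"
        using f by measurable
      fix z :: real assume "0 \<le> z" "z < 1"
      then have "\<bar>f ((real a + z) / L)\<bar> \<le> b" using sub[of a z] a b by auto
      then show "\<bar>f ((real a + z) / L) / L\<bar> \<le> b / L"
        using L by (simp add: divide_right_mono)
    qed
  qed
  finally show ?thesis .
qed

text \<open>In the application \<open>g n v\<close> is the probability that \<open>L v\<close> belongs to the \<open>n\<close>-th approximation of
  the coin tossing set, and the \<open>u \<in> B\<close> are the positions of the basic types: writing
  \<open>v = u + z\<close> with \<open>0 \<le> z < 1\<close>, \<open>u\<close> is the type and the base-\<open>L\<close> digits of \<open>z\<close> are the environment.\<close>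

locale type_recursion =
  fixes L M :: nat and t :: "nat \<Rightarrow> nat" and p :: real and B :: "int set"
    and g :: "nat \<Rightarrow> real \<Rightarrow> real"
  assumes L: "0 < L" and p: "0 < p" "p \<le> 1"
    and B: "finite B" "B \<noteq> {}"
    and g_range: "\<And>n x. 0 \<le> g n x" "\<And>n x. g n x \<le> 1"
    and g_measurable: "\<And>n. g n \<in> borel_measurable borel"
    and g_0: "\<And>u z. u \<in> B \<Longrightarrow> 0 \<le> z \<Longrightarrow> z < 1 \<Longrightarrow> g 0 (of_int u + z) = 1"
    and g_Suc: "\<And>n x. g (Suc n) x = 1 - (\<Prod>i<M. 1 - p * g n (real L * x - real (t i)))"
    and g_mono: "\<And>n x. g (Suc n) x \<le> g n x"
    and growth: "\<And>v. v \<in> B \<Longrightarrow>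
      1 < p ^ L * (\<Prod>a<L. real (card {i. i < M \<and> (\<exists>u\<in>B. v + int (t i) = u * int L + int a)}))"
begin

definition W :: "nat \<Rightarrow> real \<Rightarrow> real" where
  "W n z = (\<Sum>u\<in>B. g n (of_int u + z))"

text \<open>The column sum of the matrix of digit \<open>a\<close> at the type in position
  \<open>v\<close>, see \<open>column_sum_eq\<close>; multiplicities are included because
  \<open>i\<close> runs over the maps with repetition.\<close>

definition C :: "nat \<Rightarrow> int \<Rightarrow> nat" where
  "C a v = card {i. i < M \<and> (\<exists>u\<in>B. v + int (t i) = u * int L + int a)}"

text \<open>One vanishing column sum would annihilate the product in \<open>growth\<close>.\<close>

lemma C_pos: "v \<in> B \<Longrightarrow> a < L \<Longrightarrow> 0 < C a v"
proof (rule ccontr)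
  assume "v \<in> B" "a < L" "\<not> 0 < C a v"
  then have "(\<Prod>a<L. real (C a v)) = 0" by auto
  with growth[OF \<open>v \<in> B\<close>] show False unfolding C_def by simp
qed

lemma W_nonneg: "0 \<le> W n z"
  unfolding W_def by (intro sum_nonneg g_range)

lemma g_le_W: "v \<in> B \<Longrightarrow> g n (of_int v + z) \<le> W n z"
  unfolding W_def using B(1) by (rule member_le_sum[rotated 2]) (auto simp: g_range)

text \<open>Multiplication by \<open>L\<close> moves the first digit into the integer part: child
  \<open>i\<close> sees the position \<open>u L + a - t i\<close> and the shifted environment
  \<open>z\<close>.\<close>

lemma g_Suc_digit:
  "g (Suc n) (of_int u + (real a + z) / real L)
     = 1 - (\<Prod>i<M. 1 - p * g n (of_int (u * int L + int a - int (t i)) + z))"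
proof -
  have eq: "real L * (of_int u + (real a + z) / real L) - real (t i)
      = of_int (u * int L + int a - int (t i)) + z" for i
  proof -
    have "real L * ((real a + z) / real L) = real a + z" using L by simp
    then show ?thesis by (simp only: distrib_left of_int_diff of_int_add of_int_mult of_int_of_nat_eq) simp
  qed
  show ?thesis by (simp only: g_Suc eq)
qed

section \<open>One-step lower bounds for \<open>W\<close>\<close>

lemma pg_range: "0 \<le> p * g n x" "p * g n x \<le> 1"
  using p g_range[of n x] mult_le_one[of p "g n x"] by auto

lemma prod_range: "0 \<le> (\<Prod>i\<in>I. 1 - p * g n (h i))" "(\<Prod>i\<in>I. 1 - p * g n (h i)) \<le> 1"
  using pg_range by (auto intro!: prod_nonneg prod_le_1)

text \<open>Discarding children only enlarges a product of factors in [0, 1]. Used with a single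
  child and with all children that land in \<open>B\<close>.\<close>

lemma one_step_ge:
  assumes "I \<subseteq> {..<M}"
  shows "g (Suc n) (of_int u + (real a + z) / real L)
     \<ge> 1 - (\<Prod>i\<in>I. 1 - p * g n (of_int (u * int L + int a - int (t i)) + z))"
proof -
  let ?h = "\<lambda>i. of_int (u * int L + int a - int (t i)) + z"
  have "(\<Prod>i<M. 1 - p * g n (?h i)) = (\<Prod>i\<in>{..<M} - I. 1 - p * g n (?h i)) * (\<Prod>i\<in>I. 1 - p * g n (?h i))"
    by (rule prod.subset_diff) (use assms in auto)
  also have "\<dots> \<le> 1 * (\<Prod>i\<in>I. 1 - p * g n (?h i))"
    by (rule mult_right_mono) (rule prod_range)+
  finally show ?thesis unfolding g_Suc_digit by simp
qed

text \<open>A coarse bound: since \<open>C a v > 0\<close>, each type \<open>v\<close> is a child of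
  some type \<open>u\<close> in \<open>B\<close>, and this child alone contributes \<open>p\<close>
  times its entry. Averaging over \<open>v\<close> costs the factor \<open>card B\<close>.\<close>

lemma W_Suc_ge_W: "W (Suc n) ((real a + z) / real L) \<ge> p / card B * W n z" if a: "a < L"
proof -
  have 1: "p * g n (of_int v + z) \<le> W (Suc n) ((real a + z) / real L)" if v: "v \<in> B" for v
  proof -
    have "{i. i < M \<and> (\<exists>u\<in>B. v + int (t i) = u * int L + int a)} \<noteq> {}"
      using C_pos[OF v a] unfolding C_def by (metis card.empty less_irrefl)
    then obtain i u where i: "i < M" "u \<in> B" "v + int (t i) = u * int L + int a" by auto
    then have v: "u * int L + int a - int (t i) = v" by simp
    let ?f = "\<lambda>j. p * g n (of_int (u * int L + int a - int (t j)) + z)"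
    have "p * g n (of_int v + z) = 1 - (\<Prod>j\<in>{i}. 1 - ?f j)"
      unfolding v[symmetric] by simp
    also have "\<dots> \<le> g (Suc n) (of_int u + (real a + z) / real L)"
      by (rule one_step_ge) (use i in simp)
    also have "\<dots> \<le> W (Suc n) ((real a + z) / real L)" by (rule g_le_W) fact
    finally show ?thesis .
  qed
  have "p * W n z \<le> card B * W (Suc n) ((real a + z) / real L)"
    unfolding W_def[of n] sum_distrib_left using 1 by (intro sum_bounded_above) auto
  then show ?thesis using B by (simp add: divide_le_eq mult.commute)
qed

text \<open>\<open>S u\<close> is the entry at \<open>u\<close> of the linearised recursion, and its
  quadratic error \<open>S u * S u\<close> is at most \<open>M * W n z * S u\<close>. Summing over
  \<open>u\<close> collects the column sums.\<close>

lemma W_Suc_ge_linear: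
  "W (Suc n) ((real a + z) / real L) \<ge> (1 - M * W n z) * (\<Sum>v\<in>B. g n (of_int v + z) * (p * C a v))"
proof -
  define I where "I u = {i. i < M \<and> u * int L + int a - int (t i) \<in> B}" for u
  define S where "S u = (\<Sum>i\<in>I u. p * g n (of_int (u * int L + int a - int (t i)) + z))" for u
  have fin: "finite (I u)" for u by (simp add: I_def)
  have S0: "0 \<le> S u" for u unfolding S_def using p g_range by (intro sum_nonneg) auto
  have S_le: "S u \<le> M * W n z" for u
  proof -
    have "S u \<le> card (I u) * W n z"
      unfolding S_def
    proof (rule sum_bounded_above)
      fix i assume "i \<in> I u"
      then have "g n (of_int (u * int L + int a - int (t i)) + z) \<le> W n z"
        by (intro g_le_W) (simp add: I_def)
      then show "p * g n (of_int (u * int L + int a - int (t i)) + z) \<le> W n z"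
        using p g_range(1) by (meson mult_left_le_one_le order_trans less_imp_le)
    qed
    also have "card (I u) \<le> M"
      using card_mono[of "{..<M}" "I u"] by (auto simp: I_def)
    then have "card (I u) * W n z \<le> M * W n z"
      by (intro mult_right_mono) (auto simp: W_nonneg)
    finally show ?thesis .
  qed
  have "(1 - M * W n z) * (\<Sum>u\<in>B. S u) \<le> (\<Sum>u\<in>B. g (Suc n) (of_int u + (real a + z) / real L))"
    unfolding sum_distrib_left
  proof (rule sum_mono)
    fix u
    have "S u * S u \<le> M * W n z * S u" by (rule mult_right_mono[OF S_le S0])
    then have "(1 - M * W n z) * S u \<le> S u - (S u)\<^sup>2"
      by (simp add: power2_eq_square algebra_simps)
    also have "\<dots> \<le> 1 - (\<Prod>i\<in>I u. 1 - p * g n (of_int (u * int L + int a - int (t i)) + z))"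
      unfolding S_def by (intro one_minus_prod_ge fin conjI pg_range)
    also have "\<dots> \<le> g (Suc n) (of_int u + (real a + z) / real L)"
      by (rule one_step_ge) (auto simp: I_def)
    finally show "(1 - M * W n z) * S u \<le> g (Suc n) (of_int u + (real a + z) / real L)" .
  qed
  moreover have "(\<Sum>u\<in>B. S u) = (\<Sum>v\<in>B. g n (of_int v + z) * (p * C a v))"
  proof -
    \<comment> \<open>An incidence of \<open>v\<close>, \<open>i\<close>, \<open>u\<close> is
      counted in two ways: \<open>u\<close> and \<open>i\<close> determine \<open>v\<close>, while
      \<open>v\<close> and \<open>i\<close> determine \<open>u\<close> because
      \<open>L > 0\<close>.\<close>
    let ?f = "\<lambda>v i u. if v + int (t i) = u * int L + int a then p * g n (of_int v + z) else 0"
    have "(\<Sum>u\<in>B. S u) = (\<Sum>u\<in>B. \<Sum>i<M. \<Sum>v\<in>B. ?f v i u)"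
    proof (rule sum.cong)
      fix u assume "u \<in> B"
      have "S u = (\<Sum>i<M. if u * int L + int a - int (t i) \<in> B
          then p * g n (of_int (u * int L + int a - int (t i)) + z) else 0)"
        unfolding S_def I_def
        by (subst sum.inter_filter[symmetric]) (auto intro!: sum.cong)
      also have "\<dots> = (\<Sum>i<M. \<Sum>v\<in>B. ?f v i u)"
      proof (rule sum.cong)
        fix i
        have "(\<Sum>v\<in>B. ?f v i u) = (\<Sum>v\<in>B. if u * int L + int a - int (t i) = v
            then p * g n (of_int v + z) else 0)"
          by (intro sum.cong) auto
        then show "(if u * int L + int a - int (t i) \<in> B
          then p * g n (of_int (u * int L + int a - int (t i)) + z) else 0) = (\<Sum>v\<in>B. ?f v i u)"
          using B(1) by (simp add: sum.delta)
      qed simp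
      finally show "S u = (\<Sum>i<M. \<Sum>v\<in>B. ?f v i u)" .
    qed simp
    also have "\<dots> = (\<Sum>v\<in>B. \<Sum>i<M. \<Sum>u\<in>B. ?f v i u)"
      by (subst sum.swap, subst (2) sum.swap, subst sum.swap) simp
    also have "\<dots> = (\<Sum>v\<in>B. g n (of_int v + z) * (p * C a v))"
    proof (rule sum.cong)
      fix v
      have "(\<Sum>u\<in>B. ?f v i u) = (if \<exists>u\<in>B. v + int (t i) = u * int L + int a
          then p * g n (of_int v + z) else 0)" for i
      proof (cases "\<exists>u\<in>B. v + int (t i) = u * int L + int a")
        case True
        then obtain u0 where u0: "u0 \<in> B" "v + int (t i) = u0 * int L + int a" by auto
        then have "(\<Sum>u\<in>B. ?f v i u) = (\<Sum>u\<in>B. if u = u0 then p * g n (of_int v + z) else 0)"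
          using L by (intro sum.cong) auto
        then show ?thesis using True u0 B(1) by auto
      next
        case False
        then show ?thesis by (auto intro!: sum.neutral)
      qed
      then have "(\<Sum>i<M. \<Sum>u\<in>B. ?f v i u) = (\<Sum>i | i \<in> {..<M} \<and> (\<exists>u\<in>B. v + int (t i) = u * int L + int a).
          p * g n (of_int v + z))"
        by (subst sum.inter_filter) auto
      then show "(\<Sum>i<M. \<Sum>u\<in>B. ?f v i u) = g n (of_int v + z) * (p * C a v)"
        by (simp add: C_def mult_ac)
    qed simp
    finally show ?thesis .
  qed
  ultimately show ?thesis unfolding W_def[of "Suc n"] by simp
qed

lemma W_upper: "W n z \<le> card B"
  unfolding W_def using sum_bounded_above[of B "\<lambda>u. g n (of_int u + z)" 1] g_range by simp

text \<open>The coarse bound iterated along the digits of \<open>z\<close>. It serves to make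
  \<open>ln (W n z)\<close> well behaved: for fixed \<open>n\<close> it is bounded in
  \<open>z\<close>, hence integrable.\<close>

lemma W_lower:
  assumes "0 \<le> z" "z < 1"
  shows "(p / card B) ^ n \<le> W n z"
  using assms
proof (induction n arbitrary: z)
  case 0
  then have "W 0 z = card B" unfolding W_def by (simp add: g_0)
  then show ?case using B by (simp add: Suc_le_eq card_gt_0_iff)
next
  case (Suc n)
  \<comment> \<open>\<open>a\<close> is the leading digit of \<open>z\<close> and \<open>y\<close>
    the environment after its removal.\<close>
  define a where "a = nat \<lfloor>z * L\<rfloor>"
  define y where "y = z * L - a"
  have fl: "0 \<le> \<lfloor>z * L\<rfloor>" using Suc.prems by simp
  have y: "0 \<le> y" "y < 1" unfolding y_def a_def using fl by (simp_all add: of_nat_nat)  linarith+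
  have "z * real L < 1 * real L" by (rule mult_strict_right_mono) (use Suc.prems L in auto)
  then have "\<lfloor>z * L\<rfloor> < int L" by (simp add: floor_less_iff)
  then have a: "a < L" unfolding a_def using L by auto
  have z: "z = (real a + y) / L" unfolding y_def using L by simp
  have "(p / card B) ^ Suc n \<le> p / card B * W n y"
    unfolding power_Suc by (rule mult_left_mono[OF Suc.IH[OF y]]) (use p in simp)
  also have "\<dots> \<le> W (Suc n) z" unfolding z by (rule W_Suc_ge_W[OF a])
  finally show ?case .
qed

lemma W_pos: "0 \<le> z \<Longrightarrow> z < 1 \<Longrightarrow> 0 < W n z"
proof -
  assume "0 \<le> z" "z < 1"
  then have "(p / card B) ^ n \<le> W n z" by (rule W_lower)
  moreover have "0 < (p / card B) ^ n" using p B by (simp add: card_gt_0_iff)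
  ultimately show ?thesis by linarith
qed

section \<open>Logarithmic drift and the mean of \<open>W\<close>\<close>

lemma W_measurable: "W n \<in> borel_measurable borel"
  using g_measurable unfolding W_def[abs_def] by measurable

text \<open>The logarithm turns the growth condition into a positive sum over digits; finiteness of
  \<open>B\<close> makes the bound uniform in the type, and \<open>d\<close> is the gain per
  digit.\<close>

lemma drift_exponent:
  obtains d :: real where "0 < d" "\<And>v. v \<in> B \<Longrightarrow> L * d \<le> (\<Sum>a<L. ln (p * C a v))"
proof -
  have pos: "0 < (\<Sum>a<L. ln (p * C a v))" if v: "v \<in> B" for v
  proof -
    have "(\<Sum>a<L. ln (p * C a v)) = ln (\<Prod>a<L. p * C a v)"
      using C_pos[OF v] p by (intro ln_prod[symmetric]) auto
    also have "(\<Prod>a<L. p * C a v) = p ^ L * (\<Prod>a<L. real (C a v))"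
      by (simp add: prod.distrib)
    finally show ?thesis using growth[OF v] by (simp add: C_def)
  qed
  define m where "m = Min ((\<lambda>v. \<Sum>a<L. ln (p * C a v)) ` B)"
  have "0 < m" unfolding m_def using B pos by (subst Min_gr_iff) auto
  moreover have "m \<le> (\<Sum>a<L. ln (p * C a v))" if "v \<in> B" for v
    unfolding m_def using B that by (intro Min_le) auto
  ultimately show ?thesis using L that[of "m / L"] by simp
qed

text \<open>Where \<open>W n z\<close> is small the recursion is nearly linear and Jensen's inequality gives the
  positive drift; elsewhere the drift is only bounded below, which the term \<open>K * W n z\<close> absorbs.\<close>

lemma drift:
  obtains d K :: real where "0 < d" "0 < K" "\<And>n z. 0 \<le> z \<Longrightarrow> z < 1 \<Longrightarrow>
    ln (W n z) + d - K * W n z \<le> (\<Sum>a<L. ln (W (Suc n) ((real a + z) / L))) / L"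
proof -
  obtain d :: real where d: "0 < d" "\<And>v. v \<in> B \<Longrightarrow> L * d \<le> (\<Sum>a<L. ln (p * C a v))"
    by (rule drift_exponent) blast
  have N: "0 < card B" using B by (simp add: card_gt_0_iff)
  \<comment> \<open>Below the threshold \<open>e\<close> the nonlinear error costs at most a factor
    \<open>exp (- d / 2)\<close>, that is, half of the drift. The coarse bound loses at most
    \<open>c\<close> in \<open>ln W\<close>, and \<open>K * e = c + d / 2\<close> covers this loss
    above the threshold.\<close>
  define e where "e = (1 - exp (- d / 2)) / (M + 1)"
  define c where "c = ln (card B / p)"
  define K where "K = (c + d / 2) / e"
  have e: "0 < e" "M * e \<le> 1 - exp (- d / 2)"
  proof -
    have "0 < 1 - exp (- d / 2)" using d by simp
    then show "0 < e" unfolding e_def by simp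
    have "(M + 1) * e = 1 - exp (- d / 2)" unfolding e_def by simp
    then show "M * e \<le> 1 - exp (- d / 2)" using \<open>0 < e\<close> by (simp add: algebra_simps)
  qed
  have c: "0 \<le> c"
  proof -
    have "p \<le> card B" using p N by linarith
    then show ?thesis unfolding c_def using p by simp
  qed
  have K: "0 < K" unfolding K_def using c d e by simp
  have "ln (W n z) + d / 2 - K * W n z \<le> (\<Sum>a<L. ln (W (Suc n) ((real a + z) / L))) / L"
    if z: "0 \<le> z" "z < 1" for n z
  proof (cases "W n z < e")
    case True
    let ?w = "W n z"
    let ?g = "\<lambda>v. g n (of_int v + z)"
    have w: "0 < ?w" by (rule W_pos[OF z])
    have Mw: "exp (- d / 2) \<le> 1 - M * ?w"
      using e(2) mult_left_mono[of ?w e "real M"] True by linarith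
    \<comment> \<open>For a single digit: the nearly linear lower bound, then Jensen with the
      weights \<open>?g v / ?w\<close>.\<close>
    have "- d / 2 + ln ?w + (\<Sum>v\<in>B. (?g v / ?w) * ln (p * C a v))
        \<le> ln (W (Suc n) ((real a + z) / L))" if a: "a < L" for a
    proof -
      let ?s = "\<Sum>v\<in>B. ?g v * (p * C a v)"
      have J: "ln ?w + (\<Sum>v\<in>B. (?g v / ?w) * ln (p * C a v)) \<le> ln ?s"
      proof -
        have "0 < p * C a v" if "v \<in> B" for v using C_pos[OF that a] p by simp
        then show ?thesis
          using Jensen_ln[OF B(1), of ?g "\<lambda>v. p * C a v"] g_range(1) w
          unfolding W_def[symmetric] by blast
      qed
      have s: "0 < ?s"
      proof -
        obtain j where "j \<in> B" "0 < ?g j"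
          using w unfolding W_def by (meson not_less sum_nonpos)
        then have "0 < ?g j * (p * C a j)" using p C_pos[OF _ a] by simp
        also have "\<dots> \<le> ?s"
          using p by (intro member_le_sum B(1) \<open>j \<in> B\<close>) (simp add: g_range)
        finally show ?thesis .
      qed
      have e0: "0 < exp (- d / 2) * ?s" using s by simp
      have "- d / 2 + ln ?s = ln (exp (- d / 2) * ?s)" using s by (simp add: ln_mult)
      also have "\<dots> \<le> ln (W (Suc n) ((real a + z) / L))"
      proof -
        have "exp (- d / 2) * ?s \<le> (1 - M * ?w) * ?s"
          by (rule mult_right_mono[OF Mw]) (use s in simp)
        also have "\<dots> \<le> W (Suc n) ((real a + z) / L)" by (rule W_Suc_ge_linear)
        finally show ?thesis using e0 by simp
      qed
      finally show ?thesis using J by linarith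
    qed
    then have "(\<Sum>a<L. - d / 2 + ln ?w + (\<Sum>v\<in>B. (?g v / ?w) * ln (p * C a v)))
        \<le> (\<Sum>a<L. ln (W (Suc n) ((real a + z) / L)))"
      by (intro sum_mono) auto
    \<comment> \<open>The weights do not depend on the digit, so the sums can be exchanged. Each
      type then contributes its whole sum over digits, and no single digit has to be
      favourable.\<close>
    moreover have "(\<Sum>a<L. (\<Sum>v\<in>B. (?g v / ?w) * ln (p * C a v))) \<ge> L * d"
    proof -
      have "(\<Sum>a<L. (\<Sum>v\<in>B. (?g v / ?w) * ln (p * C a v)))
          = (\<Sum>v\<in>B. (?g v / ?w) * (\<Sum>a<L. ln (p * C a v)))"
        by (subst sum.swap) (simp add: sum_distrib_left)
      also have "\<dots> \<ge> (\<Sum>v\<in>B. (?g v / ?w) * (L * d))"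
        using d(2) g_range w by (intro sum_mono mult_left_mono) auto
      moreover have "(\<Sum>v\<in>B. (?g v / ?w) * (L * d)) = L * d"
      proof -
        have "(\<Sum>v\<in>B. (?g v / ?w)) = 1"
          using w by (simp add: sum_divide_distrib[symmetric] W_def)
        then show ?thesis by (simp only: sum_distrib_right[symmetric])
      qed
      ultimately show ?thesis by simp
    qed
    ultimately have "L * (- d / 2 + ln ?w) + L * d \<le> (\<Sum>a<L. ln (W (Suc n) ((real a + z) / L)))"
      by (simp add: sum.distrib)
    then have "L * (ln ?w + d / 2) \<le> (\<Sum>a<L. ln (W (Suc n) ((real a + z) / L)))"
      by (simp add: algebra_simps)
    then have "ln ?w + d / 2 \<le> (\<Sum>a<L. ln (W (Suc n) ((real a + z) / L))) / L"
      using L by (simp add: le_divide_eq mult.commute)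
    moreover have "0 \<le> K * ?w" using K w by simp
    ultimately show ?thesis by linarith
  next
    case False
    let ?w = "W n z"
    have w: "0 < ?w" by (rule W_pos[OF z])
    \<comment> \<open>Above the threshold the coarse bound suffices.\<close>
    have "ln ?w - c \<le> ln (W (Suc n) ((real a + z) / L))" if a: "a < L" for a
    proof -
      have pos: "0 < p / card B * ?w" using p N w by simp
      have "ln ?w - c = ln (p / card B * ?w)"
        unfolding c_def using p N w by (simp add: ln_mult ln_div)
      also have "\<dots> \<le> ln (W (Suc n) ((real a + z) / L))"
        using W_Suc_ge_W[OF a, of n z] pos by simp
      finally show ?thesis .
    qed
    then have "L * (ln ?w - c) \<le> (\<Sum>a<L. ln (W (Suc n) ((real a + z) / L)))"
      using sum_bounded_below[of "{..<L}" "ln ?w - c"] by simp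
    then have "ln ?w - c \<le> (\<Sum>a<L. ln (W (Suc n) ((real a + z) / L))) / L"
      using L by (simp add: le_divide_eq mult.commute)
    moreover have "c + d / 2 \<le> K * ?w"
    proof -
      have "c + d / 2 = K * e" unfolding K_def using e by simp
      also have "\<dots> \<le> K * ?w" using K False by (intro mult_left_mono) auto
      finally show ?thesis .
    qed
    ultimately show ?thesis by linarith
  qed
  then show ?thesis using that[of "d / 2" K] d K by simp
qed

text \<open>The integrated drift reads \<open>V n + d - K * J n \<le> V (Suc n)\<close>. If
  \<open>J n\<close> ever fell below \<open>d / (2 * K)\<close>, it would stay there by
  monotonicity, and \<open>V\<close> would gain \<open>d / 2\<close> at every later step, beyond its
  bound \<open>ln (card B)\<close>.\<close>

lemma integral_W_bounded_below:
  obtains c :: real where "0 < c" "\<And>n. c \<le> (\<integral>z. W n z \<partial>unit_uniform)"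
proof -
  obtain d K :: real where d: "0 < d" and K: "0 < K" and dr: "\<And>n z. 0 \<le> z \<Longrightarrow> z < 1 \<Longrightarrow>
    ln (W n z) + d - K * W n z \<le> (\<Sum>a<L. ln (W (Suc n) ((real a + z) / L))) / L"
    by (rule drift) blast
  interpret U: prob_space unit_uniform by (rule prob_space_unit_uniform)
  have N: "0 < card B" using B by (simp add: card_gt_0_iff)
  define J where "J n = (\<integral>z. W n z \<partial>unit_uniform)" for n
  define V where "V n = (\<integral>z. ln (W n z) \<partial>unit_uniform)" for n
  have lnW: "\<bar>ln (W n z)\<bar> \<le> \<bar>ln (card B)\<bar> + \<bar>ln ((p / card B) ^ n)\<bar>"
    if z: "0 \<le> z" "z < 1" for n z
  proof -
    have "0 < (p / card B) ^ n" using p N by simp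
    then have "ln ((p / card B) ^ n) \<le> ln (W n z)" using W_lower[OF z] W_pos[OF z] by (subst ln_le_cancel_iff) auto
    moreover have "ln (W n z) \<le> ln (card B)"
      using W_upper[of n z] W_pos[OF z, of n] N by (subst ln_le_cancel_iff) auto
    ultimately show ?thesis by linarith
  qed
  have int_ln: "integrable unit_uniform (\<lambda>z. ln (W n z))" for n
    by (rule integrable_unit_uniform[OF _ lnW]) (use W_measurable in measurable)
  have int_W: "integrable unit_uniform (W n)" for n
    by (rule integrable_unit_uniform[OF W_measurable, of _ "card B"])
      (simp add: W_upper W_nonneg)
  have J_mono: "J (Suc n) \<le> J n" for n
    unfolding J_def
    by (rule integral_mono[OF int_W int_W]) (auto simp: W_def intro!: sum_mono g_mono)
  then have J_dec: "m \<le> n \<Longrightarrow> J n \<le> J m" for m n by (rule lift_Suc_antimono_le)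
  have V_upper: "V n \<le> ln (card B)" for n
  proof -
    have "V n \<le> (\<integral>z. ln (card B) \<partial>unit_uniform)"
      unfolding V_def
      using W_upper W_pos N by (intro integral_mono int_ln) (auto simp: ln_le_cancel_iff)
    then show ?thesis by simp
  qed
  have V_Suc: "V n + d - K * J n \<le> V (Suc n)" for n
  proof -
    \<comment> \<open>Prepending a uniform digit to a uniform environment gives a uniform
      environment, so the digit average in \<open>dr\<close> integrates to
      \<open>V (Suc n)\<close>.\<close>
    have eq: "V (Suc n) = (\<integral>z. (\<Sum>a<L. ln (W (Suc n) ((real a + z) / L))) / L \<partial>unit_uniform)"
      unfolding V_def
      by (rule integral_unit_uniform_split[OF L _ lnW]) (use W_measurable in measurable)
    have "V n + d - K * J n = (\<integral>z. ln (W n z) + d - K * W n z \<partial>unit_uniform)"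
      unfolding V_def J_def using int_ln int_W by simp
    also have "\<dots> \<le> V (Suc n)"
      unfolding eq
    proof (rule integral_mono)
      show "integrable unit_uniform (\<lambda>z. ln (W n z) + d - K * W n z)"
        using int_ln int_W by simp
      show "integrable unit_uniform (\<lambda>z. (\<Sum>a<L. ln (W (Suc n) ((real a + z) / L))) / L)"
      proof (intro integrable_divide Bochner_Integration.integrable_sum integrable_unit_uniform)
        fix a assume "a \<in> {..<L}"
        show "(\<lambda>z. ln (W (Suc n) ((real a + z) / L))) \<in> borel_measurable borel"
          using W_measurable by measurable
        fix z :: real assume "0 \<le> z" "z < 1"
        then show "\<bar>ln (W (Suc n) ((real a + z) / L))\<bar> \<le> \<bar>ln (card B)\<bar> + \<bar>ln ((p / card B) ^ Suc n)\<bar>"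
          using \<open>a \<in> {..<L}\<close> L by (intro lnW) (auto simp: divide_less_eq)
      qed
    qed (auto intro: dr)
    finally show ?thesis .
  qed
  have "d / (2 * K) \<le> J n" for n
  proof (rule ccontr)
    assume "\<not> d / (2 * K) \<le> J n"
    then have "K * J m \<le> d / 2" if "n \<le> m" for m
    proof -
      have "K * J m \<le> K * J n" using J_dec[OF that] K by (intro mult_left_mono) auto
      moreover have "K * J n \<le> d / 2"
        using \<open>\<not> d / (2 * K) \<le> J n\<close> K by (simp add: field_simps)
      ultimately show ?thesis by linarith
    qed
    note KJ = this
    have step: "V m + d / 2 \<le> V (Suc m)" if "n \<le> m" for m
      using V_Suc[of m] KJ[OF that] by linarith
    have "V n + k * (d / 2) \<le> V (n + k)" for k
    proof (induction k)
      case (Suc k)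
      have "Suc k * (d / 2) = k * (d / 2) + d / 2"
        by (simp add: distrib_right add_divide_distrib)
      then have "V n + Suc k * (d / 2) \<le> V (n + k) + d / 2" using Suc by linarith
      also have "\<dots> \<le> V (n + Suc k)" using step[of "n + k"] by simp
      finally show ?case .
    qed simp
    moreover obtain k :: nat where "(ln (card B) - V n) / (d / 2) < k"
      using reals_Archimedean2 by blast
    then have "ln (card B) < V n + k * (d / 2)" using d by (simp add: field_simps)
    ultimately show False using V_upper[of "n + k"] by (meson not_le order_trans)
  qed
  then show ?thesis using that[of "d / (2 * K)"] d K unfolding J_def by simp
qed

end

subsection \<open>Approximations of the limit set\<close>

abbreviation survivors :: "nat \<Rightarrow> nat \<Rightarrow> (nat list \<Rightarrow> bool) \<Rightarrow> nat list set" where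
  "survivors M n x \<equiv> surviving_words M (\<lambda>w x. x w) n x"

text \<open>The starting set \<open>K\<close> is left free: the base interval gives the coin tossing
  set, while the covering recursion starts from a larger interval that contains every basic
  type.\<close>

definition approx :: "nat \<Rightarrow> nat \<Rightarrow> (nat \<Rightarrow> nat) \<Rightarrow> real set \<Rightarrow> nat \<Rightarrow> (nat list \<Rightarrow> bool) \<Rightarrow> real set" where
  "approx L M t K n x = (\<Union>w\<in>survivors M n x. word_map L t w ` K)"

lemma survivors_0 [simp]: "survivors M 0 x = {[]}"
  by (auto simp: surviving_words_def)

lemma Cons_survivors_iff:
  "i # w \<in> survivors M (Suc n) x \<longleftrightarrow> i < M \<and> x [i] \<and> w \<in> survivors M n (subtree M i x)"
proof -
  have "(\<forall>k\<in>{1..Suc n}. x (take k (i # w))) \<longleftrightarrow> x [i] \<and> (\<forall>k\<in>{1..n}. x (i # take k w))"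
  proof -
    have eq: "{1..Suc n} = insert 1 (Suc ` {1..n})"
      by (auto simp: image_iff)
    show ?thesis unfolding eq by (simp del: image_Suc_atLeastAtMost)
  qed
  moreover have "subtree M i x (take k w) = x (i # take k w)"
    if "length w = n" "set w \<subseteq> {..<M}" "k \<in> {1..n}" for k
  proof -
    have "take k w \<in> nonempty_words M"
      using that set_take_subset[of k w] by (auto simp: nonempty_words_def)
    then show ?thesis by (simp add: subtree_def)
  qed
  ultimately show ?thesis by (auto simp: surviving_words_def)
qed

lemma survivors_Suc:
  "survivors M (Suc n) x = (\<Union>i\<in>{i. i < M \<and> x [i]}. (#) i ` survivors M n (subtree M i x))"
proof (intro equalityI subsetI)
  fix w assume w: "w \<in> survivors M (Suc n) x"
  then obtain i v where "w = i # v" by (cases w) (auto simp: surviving_words_def)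
  with w show "w \<in> (\<Union>i\<in>{i. i < M \<and> x [i]}. (#) i ` survivors M n (subtree M i x))"
    by (auto simp: Cons_survivors_iff)
qed (auto simp: Cons_survivors_iff)

lemma finite_words: "finite {w. length w = n \<and> set w \<subseteq> {..<M::nat}}"
  using finite_lists_length_eq[of "{..<M}" n] by (simp add: conj_commute)

lemma finite_survivors: "finite (survivors M n x)"
  by (rule finite_subset[OF _ finite_words[of n M]]) (auto simp: surviving_words_def)

lemma approx_0 [simp]: "approx L M t K 0 x = K"
  by (simp add: approx_def)

lemma approx_Suc:
  "approx L M t K (Suc n) x
     = (\<Union>i\<in>{i. i < M \<and> x [i]}. ifs_map L t i ` approx L M t K n (subtree M i x))"
  unfolding approx_def survivors_Suc by (auto simp: image_iff)

lemma approx_decreasing: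
  assumes "\<And>i. i < M \<Longrightarrow> ifs_map L t i ` K \<subseteq> K"
  shows "approx L M t K (Suc n) x \<subseteq> approx L M t K n x"
proof (induction n arbitrary: x)
  case 0
  show ?case using assms by (fastforce simp: approx_Suc)
next
  case (Suc n)
  show ?case
    by (subst (1 2) approx_Suc) (use Suc.IH in blast)
qed

lemma approx_antimono:
  assumes "\<And>i. i < M \<Longrightarrow> ifs_map L t i ` K \<subseteq> K" "m \<le> n"
  shows "approx L M t K n x \<subseteq> approx L M t K m x"
  by (rule lift_Suc_antimono_le[of "\<lambda>n. approx L M t K n x"]) (use assms approx_decreasing in auto)

section \<open>Compactness, comparison of starting sets, and self-similarity of the limit\<close>

lemma continuous_word_map: "continuous_on A (word_map L t w)"
proof (induction w arbitrary: A)
  case (Cons i w)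
  have "continuous_on B (ifs_map L t i)" for B
    unfolding ifs_map_def[abs_def] by (cases "L = 0") (auto intro!: continuous_intros)
  with Cons show ?case unfolding word_map.simps by (intro continuous_on_compose)
qed (simp add: continuous_on_id')

lemma compact_approx: "compact K \<Longrightarrow> compact (approx L M t K n x)"
  unfolding approx_def
  by (intro compact_UN finite_survivors compact_continuous_image continuous_word_map)

lemma word_map_diff: "word_map L t w y - word_map L t w z = (y - z) / real L ^ length w"
proof (induction w)
  case (Cons i w)
  have "word_map L t (i # w) y - word_map L t (i # w) z
      = (word_map L t w y - word_map L t w z) / real L"
    by (simp add: ifs_map_def diff_divide_distrib)
  then show ?case by (simp add: Cons)
qed simp

text \<open>A point coded by a surviving word of length \<open>n\<close> is within
  \<open>R / L ^ n\<close> of the image of 0 under that word, which lies in the approximation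
  started from \<open>I\<close>. Closedness gives the limit.\<close>

lemma Inter_approx_subset:
  assumes L: "1 < L" and inv: "\<And>i. i < M \<Longrightarrow> ifs_map L t i ` I \<subseteq> I"
    and I: "compact I" "0 \<in> I" and K: "bounded K"
  shows "(\<Inter>n. approx L M t K n x) \<subseteq> (\<Inter>n. approx L M t I n x)"
proof (intro subsetI INT_I)
  fix y m assume y: "y \<in> (\<Inter>n. approx L M t K n x)"
  obtain R where R: "\<And>z. z \<in> K \<Longrightarrow> \<bar>z\<bar> \<le> R"
    using K unfolding bounded_iff by auto
  have "closed (approx L M t I m x)" by (intro compact_imp_closed compact_approx I)
  moreover have "\<exists>y'\<in>approx L M t I m x. dist y' y < e" if e: "0 < e" for e
  proof -
    have "(\<lambda>n. R / real L ^ n) \<longlonglongrightarrow> 0"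
      using L by (intro LIMSEQ_divide_realpow_zero) simp
    then have "\<forall>\<^sub>F n in sequentially. R / real L ^ n < e" using e by (rule order_tendstoD)
    then obtain n where n: "m \<le> n" "R / real L ^ n < e"
      using eventually_happens[OF eventually_conj[OF eventually_ge_at_top[of m]]] by auto
    from y have "y \<in> approx L M t K n x" by blast
    then obtain w z where w: "w \<in> survivors M n x" and z: "z \<in> K" "y = word_map L t w z"
      by (auto simp: approx_def)
    have "word_map L t w 0 \<in> approx L M t I n x" using w I by (auto simp: approx_def)
    then have "word_map L t w 0 \<in> approx L M t I m x"
      using approx_antimono[OF inv n(1)] by blast
    moreover have "dist (word_map L t w 0) y < e"
    proof -
      have "length w = n" using w by (simp add: surviving_words_def)
      then have "dist (word_map L t w 0) y = \<bar>z\<bar> / real L ^ n"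
        by (simp add: dist_real_def z(2) word_map_diff abs_divide power_abs)
      also have "\<dots> \<le> R / real L ^ n" by (intro divide_right_mono R z) simp
      finally show ?thesis using n(2) by simp
    qed
    ultimately show ?thesis by blast
  qed
  ultimately show "y \<in> approx L M t I m x" using closed_approachable by blast
qed

text \<open>If each \<open>i\<close> failed at some stage, all would fail at the largest of these
  stages. This Koenig-type argument exchanges an intersection over \<open>n\<close> with a finite
  union over children.\<close>

lemma finite_pigeonhole_antimono:
  assumes "finite A" "\<And>i n. i \<in> A \<Longrightarrow> Q i (Suc n) \<Longrightarrow> Q i n" "\<And>n::nat. \<exists>i\<in>A. Q i n"
  shows "\<exists>i\<in>A. \<forall>n. Q i n"
proof (rule ccontr)
  assume "\<not> ?thesis"
  then have "\<forall>i\<in>A. \<exists>n. \<not> Q i n" by blast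
  then obtain N where N: "\<And>i. i \<in> A \<Longrightarrow> \<not> Q i (N i)" by metis
  obtain i where i: "i \<in> A" "Q i (Max (N ` A))" using assms(3) by blast
  have "N i \<le> Max (N ` A)" using assms(1) i(1) by simp
  then have "Q i (N i)"
    by (induction rule: inc_induct) (fact i(2), erule assms(2)[OF i(1)])
  with N[OF i(1)] show False ..
qed

lemma inj_ifs_map: "0 < L \<Longrightarrow> inj (ifs_map L t i)"
  by (auto simp: inj_def ifs_map_def)

text \<open>The pigeonhole principle fixes one child that covers \<open>y\<close> at all stages;
  injectivity of its map makes the preimage of \<open>y\<close> the same at every stage.\<close>

lemma Inter_approx_recursion:
  assumes L: "0 < L" and inv: "\<And>i. i < M \<Longrightarrow> ifs_map L t i ` K \<subseteq> K"
  shows "(\<Inter>n. approx L M t K n x)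
    = (\<Union>i\<in>{i. i < M \<and> x [i]}. ifs_map L t i ` (\<Inter>n. approx L M t K n (subtree M i x)))"
    (is "?l = ?r")
proof (intro equalityI subsetI)
  let ?D = "\<lambda>n x. approx L M t K n x"
  have dec: "?D (Suc n) z \<subseteq> ?D n z" for n z by (rule approx_decreasing[OF inv])
  fix y
  {
    assume y: "y \<in> ?l"
    have "\<exists>i\<in>{i. i < M \<and> x [i]}. \<forall>n. y \<in> ifs_map L t i ` ?D n (subtree M i x)"
    proof (rule finite_pigeonhole_antimono)
      show "y \<in> ifs_map L t i ` ?D n (subtree M i x)"
        if "y \<in> ifs_map L t i ` ?D (Suc n) (subtree M i x)" for i n
        using that image_mono[OF dec] by (rule subsetD[rotated])
      show "\<exists>i\<in>{i. i < M \<and> x [i]}. y \<in> ifs_map L t i ` ?D n (subtree M i x)" for n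
      proof -
        have "y \<in> ?D (Suc n) x" using y by (rule INT_D) simp
        then show ?thesis unfolding approx_Suc by (simp only: UN_iff)
      qed
    qed simp
    then obtain i where "i \<in> {i. i < M \<and> x [i]}" and im: "\<forall>n. y \<in> ifs_map L t i ` ?D n (subtree M i x)"
      by (rule bexE)
    then have i: "i < M" "x [i]" by simp_all
    obtain z where z: "y = ifs_map L t i z" using im[rule_format, of 0] by (rule imageE)
    have "z \<in> ?D n (subtree M i x)" for n
      using im[rule_format, of n] unfolding z by (simp add: inj_image_mem_iff[OF inj_ifs_map[OF L]])
    then have "y \<in> ifs_map L t i ` (\<Inter>n. ?D n (subtree M i x))"
      unfolding z by (intro imageI INT_I)
    then show "y \<in> ?r" using i by (intro UN_I[of i]) simp_all
  next
    assume "y \<in> ?r"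
    then obtain i z where "i \<in> {i. i < M \<and> x [i]}" and z: "y = ifs_map L t i z"
      and "z \<in> (\<Inter>n. ?D n (subtree M i x))"
      by (elim UN_E imageE)
    then have i: "i < M" "x [i]" and zD: "\<forall>n. z \<in> ?D n (subtree M i x)" by simp_all
    have "y \<in> ?D (Suc n) x" for n
      unfolding approx_Suc z using i zD by (intro UN_I[of i] imageI) simp_all
    then have "y \<in> ?D n x" for n by (rule subsetD[OF dec])
    then show "y \<in> ?l" by (rule INT_I)
  }
qed

section \<open>Branching characterisations of positive measure and of survival\<close>

lemma emeasure_ifs_map_image:
  assumes "S \<in> sets borel" "ifs_map L t i ` S \<in> sets borel" and L: "0 < L"
  shows "emeasure lborel (ifs_map L t i ` S) = ennreal (1 / L) * emeasure lborel S"
proof -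
  have "ifs_map L t i = (\<lambda>x. (1 / real L) *\<^sub>R x + real (t i))"
    by (simp add: ifs_map_def fun_eq_iff)
  then show ?thesis
    using emeasure_lebesgue_affine[of "1 / real L" "real (t i)" S] assms
    by (simp add: emeasure_completion main_part_sets)
qed

text \<open>The limit set is a finite union of copies scaled by \<open>1 / L\<close>, so it is null
  exactly when all the copies are.\<close>

lemma emeasure_Inter_approx_pos_iff:
  assumes L: "0 < L" and inv: "\<And>i. i < M \<Longrightarrow> ifs_map L t i ` K \<subseteq> K" and K: "compact K"
  shows "0 < emeasure lborel (\<Inter>n. approx L M t K n x)
    \<longleftrightarrow> (\<exists>i<M. x [i] \<and> 0 < emeasure lborel (\<Inter>n. approx L M t K n (subtree M i x)))"
proof -
  let ?Z = "\<lambda>x. \<Inter>n. approx L M t K n x"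
  have cZ: "compact (?Z x)" for x
  proof -
    have "compact (approx L M t K 0 x \<inter> ?Z x)"
      by (intro compact_Int_closed closed_INT ballI compact_imp_closed compact_approx K)
    moreover have "approx L M t K 0 x \<inter> ?Z x = ?Z x" by blast
    ultimately show ?thesis by (simp only:)
  qed
  have bZ: "?Z x \<in> sets borel" for x using cZ by (rule borel_compact)
  have fZ: "ifs_map L t i ` ?Z x \<in> sets borel" for i x
  proof (intro borel_compact compact_continuous_image cZ)
    show "continuous_on (?Z x) (ifs_map L t i)"
      using continuous_word_map[of _ L t "[i]"] by simp
  qed
  have "emeasure lborel (?Z x) = 0 \<longleftrightarrow>
      (\<forall>i\<in>{i. i < M \<and> x [i]}. emeasure lborel (ifs_map L t i ` ?Z (subtree M i x)) = 0)"
  proof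
    assume 0: "emeasure lborel (?Z x) = 0"
    show "\<forall>i\<in>{i. i < M \<and> x [i]}. emeasure lborel (ifs_map L t i ` ?Z (subtree M i x)) = 0"
    proof
      fix i assume "i \<in> {i. i < M \<and> x [i]}"
      then have "ifs_map L t i ` ?Z (subtree M i x) \<subseteq> ?Z x"
        using Inter_approx_recursion[where x = x, OF L inv] by blast
      then show "emeasure lborel (ifs_map L t i ` ?Z (subtree M i x)) = 0"
        using 0 emeasure_mono[of _ "?Z x" lborel] bZ by (metis le_zero_eq sets_lborel)
    qed
  next
    assume "\<forall>i\<in>{i. i < M \<and> x [i]}. emeasure lborel (ifs_map L t i ` ?Z (subtree M i x)) = 0"
    then have "(\<Union>i\<in>{i. i < M \<and> x [i]}. ifs_map L t i ` ?Z (subtree M i x)) \<in> null_sets lborel"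
      by (intro null_sets.finite_UN) (auto simp: null_sets_def fZ)
    then show "emeasure lborel (?Z x) = 0"
      using Inter_approx_recursion[where x = x, OF L inv] by auto
  qed
  moreover have "emeasure lborel (ifs_map L t i ` ?Z (subtree M i x)) = 0
      \<longleftrightarrow> emeasure lborel (?Z (subtree M i x)) = 0" for i
    using emeasure_ifs_map_image[OF bZ fZ L] L by simp
  ultimately show ?thesis by (auto simp: zero_less_iff_neq_zero)
qed

text \<open>The counterpart for survival; here the pigeonhole principle selects one child whose tree
  survives at all depths.\<close>

lemma all_survivors_iff:
  "(\<forall>n. survivors M n x \<noteq> {}) \<longleftrightarrow> (\<exists>i<M. x [i] \<and> (\<forall>n. survivors M n (subtree M i x) \<noteq> {}))"
proof
  assume a: "\<forall>n. survivors M n x \<noteq> {}"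
  have "\<exists>i\<in>{i. i < M \<and> x [i]}. \<forall>n. survivors M n (subtree M i x) \<noteq> {}"
  proof (rule finite_pigeonhole_antimono)
    show "survivors M n y \<noteq> {}" if "survivors M (Suc n) y \<noteq> {}" for y n
      using that
    proof (induction n arbitrary: y)
      case (Suc n)
      from Suc.prems obtain i where "i < M" "y [i]" "survivors M (Suc n) (subtree M i y) \<noteq> {}"
        by (subst (asm) survivors_Suc) auto
      with Suc.IH show ?case by (subst survivors_Suc) auto
    qed simp
    show "\<exists>i\<in>{i. i < M \<and> x [i]}. survivors M n (subtree M i x) \<noteq> {}" for n
      using a[rule_format, of "Suc n"] unfolding survivors_Suc by auto
  qed simp
  then show "\<exists>i<M. x [i] \<and> (\<forall>n. survivors M n (subtree M i x) \<noteq> {})" by auto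
next
  assume a: "\<exists>i<M. x [i] \<and> (\<forall>n. survivors M n (subtree M i x) \<noteq> {})"
  show "\<forall>n. survivors M n x \<noteq> {}"
  proof
    fix n
    show "survivors M n x \<noteq> {}"
      using a by (cases n) (simp, auto simp: survivors_Suc)
  qed
qed

lemma non_extinct_iff: "non_extinct M (\<lambda>w x. x w) x \<longleftrightarrow> (\<forall>n. survivors M n x \<noteq> {})"
proof -
  have "survivors M n x \<noteq> {}" if "\<forall>n\<ge>1. survivors M n x \<noteq> {}" for n
    using that by (cases n) auto
  then show ?thesis unfolding non_extinct_def by blast
qed

section \<open>The coin tossing set as an intersection of approximations\<close>

lemma base_interval_invariant:
  assumes "integer_ifs L M t" "i < M"
  shows "ifs_map L t i ` base_interval L M t \<subseteq> base_interval L M t"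
proof
  let ?T = "real (t (M - 1))"
  have L: "2 \<le> L" and ti: "real (t i) \<le> ?T" using assms by (auto simp: integer_ifs_def)
  fix y assume "y \<in> ifs_map L t i ` base_interval L M t"
  then obtain z where z: "0 \<le> z" "z \<le> real L * ?T / (real L - 1)" "y = z / real L + real (t i)"
    by (auto simp: base_interval_def ifs_map_def)
  have "z / real L \<le> real L * ?T / (real L - 1) / real L" using z(2) by (rule divide_right_mono) simp
  also have "\<dots> = ?T / (real L - 1)" using L by simp
  finally have "y \<le> ?T / (real L - 1) + ?T" using z ti by linarith
  \<comment> \<open>The right endpoint is the fixed point of the map with the largest
    translation.\<close>
  also have "\<dots> = real L * ?T / (real L - 1)" using L by (simp add: field_simps)
  finally show "y \<in> base_interval L M t" using z by (simp add: base_interval_def)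
qed

lemma coin_tossing_set_eq:
  assumes "integer_ifs L M t"
  shows "coin_tossing_set L M t (\<lambda>w x. x w) x = (\<Inter>n. approx L M t (base_interval L M t) n x)"
proof -
  let ?D = "\<lambda>n. approx L M t (base_interval L M t) n x"
  \<comment> \<open>The coin tossing set intersects the stages from 1 on; stage 0 contains stage 1
    and can be added.\<close>
  have "?D 1 \<subseteq> ?D 0"
    using approx_decreasing[where K = "base_interval L M t" and n = 0] base_interval_invariant[OF assms]
    by simp
  then have "(\<Inter>n\<in>{1..}. ?D n) \<subseteq> ?D n" for n
    by (cases n) force+
  then show ?thesis unfolding coin_tossing_set_def approx_def[symmetric] by blast
qed

text \<open>Survival looks only at nonempty prefixes, so the labels can be replaced by a point of
  the canonical space.\<close>

lemma surviving_words_restrict: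
  "surviving_words M X n \<omega> = survivors M n (\<lambda>w\<in>nonempty_words M. X w \<omega>)"
proof -
  have "take k w \<in> nonempty_words M" if "length w = n" "set w \<subseteq> {..<M}" "k \<in> {1..n}" for k w
    using that set_take_subset[of k w] by (auto simp: nonempty_words_def)
  then show ?thesis by (auto simp: surviving_words_def)
qed

section \<open>Measurability\<close>

lemma survivors_measurable:
  "Measurable.pred (coin_space M p) (\<lambda>x. w \<in> survivors M n x)"
proof (cases "length w = n \<and> set w \<subseteq> {..<M}")
  case True
  have "take k w \<in> nonempty_words M" if "k \<in> {1..n}" for k
    using True that set_take_subset[of k w] by (auto simp: nonempty_words_def)
  then have "Measurable.pred (coin_space M p) (\<lambda>x. \<forall>k\<in>{1..n}. x (take k w))"
    by (intro pred_intros_finite coordinate_measurable) auto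
  then show ?thesis using True by (simp add: surviving_words_def)
next
  case False
  then have "(\<lambda>x. w \<in> survivors M n x) = (\<lambda>x. False)" by (auto simp: surviving_words_def)
  then show ?thesis by simp
qed

text \<open>Joint measurability, as Fubini requires: the set is a finite union of rectangles, one
  for each word of length \<open>n\<close>.\<close>

lemma approx_measurable:
  assumes "compact K"
  shows "{z \<in> space (coin_space M p \<Otimes>\<^sub>M lborel). snd z \<in> approx L M t K n (fst z)}
           \<in> sets (coin_space M p \<Otimes>\<^sub>M lborel)"
proof -
  let ?W = "{w. length w = n \<and> set w \<subseteq> {..<M}}"
  have "{z \<in> space (coin_space M p \<Otimes>\<^sub>M lborel). snd z \<in> approx L M t K n (fst z)}
    = (\<Union>w\<in>?W. {x \<in> space (coin_space M p). w \<in> survivors M n x} \<times> (word_map L t w ` K))"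
    by (auto simp: approx_def space_pair_measure surviving_words_def)
  also have "\<dots> \<in> sets (coin_space M p \<Otimes>\<^sub>M lborel)"
  proof (intro sets.finite_UN finite_words pair_measureI)
    fix w
    show "{x \<in> space (coin_space M p). w \<in> survivors M n x} \<in> sets (coin_space M p)"
      using survivors_measurable by measurable
    show "word_map L t w ` K \<in> sets lborel"
      by (simp add: borel_compact compact_continuous_image assms continuous_word_map)
  qed
  finally show ?thesis .
qed

lemma Inter_approx_measurable:
  assumes "compact K"
  shows "{z \<in> space (coin_space M p \<Otimes>\<^sub>M lborel). snd z \<in> (\<Inter>n. approx L M t K n (fst z))}
           \<in> sets (coin_space M p \<Otimes>\<^sub>M lborel)"
proof -
  have "{z \<in> space (coin_space M p \<Otimes>\<^sub>M lborel). snd z \<in> (\<Inter>n. approx L M t K n (fst z))}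
    = (\<Inter>n. {z \<in> space (coin_space M p \<Otimes>\<^sub>M lborel). snd z \<in> approx L M t K n (fst z)})"
    by auto
  also have "\<dots> \<in> sets (coin_space M p \<Otimes>\<^sub>M lborel)"
    by (rule sets.countable_INT) (auto simp only: intro!: approx_measurable[OF assms])
  finally show ?thesis .
qed

subsection \<open>Positive measure\<close>

lemma approx_section_sets:
  assumes "compact K"
  shows "{x \<in> space (coin_space M p). y \<in> approx L M t K n x} \<in> sets (coin_space M p)"
proof -
  have "(\<lambda>x. (x, y)) -` {z \<in> space (coin_space M p \<Otimes>\<^sub>M lborel). snd z \<in> approx L M t K n (fst z)}
      \<in> sets (coin_space M p)"
    by (rule sets_Pair2[OF approx_measurable[OF assms]])
  then show ?thesis by (simp add: space_pair_measure vimage_def)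
qed

text \<open>Inverting the map of child \<open>i\<close> sends \<open>y\<close> to
  \<open>L (y - t i)\<close>, so the branching identity applies with one event per child.\<close>

lemma prob_approx_Suc:
  assumes L: "0 < L" and p: "0 \<le> p" "p \<le> 1" and K: "compact K"
  shows "measure (coin_space M p) {x \<in> space (coin_space M p). y \<in> approx L M t K (Suc n) x}
     = 1 - (\<Prod>i<M. 1 - p * measure (coin_space M p)
              {x \<in> space (coin_space M p). real L * (y - real (t i)) \<in> approx L M t K n x})"
proof -
  let ?S = "space (coin_space M p)"
  let ?A = "\<lambda>i. {x \<in> ?S. real L * (y - real (t i)) \<in> approx L M t K n x}"
  have img: "y \<in> ifs_map L t i ` Z \<longleftrightarrow> real L * (y - real (t i)) \<in> Z" for i Z
  proof
    assume "real L * (y - real (t i)) \<in> Z"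
    moreover have "y = ifs_map L t i (real L * (y - real (t i)))" using L by (simp add: ifs_map_def)
    ultimately show "y \<in> ifs_map L t i ` Z" by blast
  qed (use L in \<open>auto simp: ifs_map_def\<close>)
  have "{x \<in> ?S. y \<in> approx L M t K (Suc n) x} = {x \<in> ?S. \<exists>i<M. x [i] \<and> subtree M i x \<in> ?A i}"
    using measurable_space[OF subtree_measurable] by (auto simp: approx_Suc img)
  then show ?thesis
    using measure_branching[OF p, of M ?A] approx_section_sets[OF K] by simp
qed

text \<open>If the limit were almost surely null, Fubini would force the covering probability of
  almost every point to tend to 0, and dominated convergence would send the mean of \<open>W\<close>
  to 0, against its lower bound.\<close>

lemma not_AE_limit_null:
  assumes L: "2 \<le> L" and p: "0 < p" "p \<le> 1" and B: "finite B" "B \<noteq> {}"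
    and growth: "\<And>v. v \<in> B \<Longrightarrow>
      1 < p ^ L * (\<Prod>a<L. real (card {i. i < M \<and> (\<exists>u\<in>B. v + int (t i) = u * int L + int a)}))"
    and I: "compact I" "0 \<in> I" "\<And>i. i < M \<Longrightarrow> ifs_map L t i ` I \<subseteq> I"
  shows "\<not> (AE x in coin_space M p. emeasure lborel (\<Inter>n. approx L M t I n x) = 0)"
proof
  assume null: "AE x in coin_space M p. emeasure lborel (\<Inter>n. approx L M t I n x) = 0"
  let ?P = "coin_space M p"
  interpret P: prob_space ?P by (rule prob_space_coin_space)
  interpret PL: pair_sigma_finite ?P lborel ..
  interpret U: prob_space unit_uniform by (rule prob_space_unit_uniform)
  \<comment> \<open>\<open>R\<close> is large enough for \<open>K\<close> to contain every interval
    with position in \<open>B\<close>, which gives \<open>g 0 = 1\<close> there. It also makes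
    \<open>K\<close> invariant: \<open>R / L + T\<close> is at most \<open>2 * (b + 1 + T)\<close>,
    hence at most \<open>R\<close> since \<open>L\<close> is at least 2.\<close>
  define T where "T = real (\<Sum>i<M. t i)"
  define b where "b = real_of_int (\<Sum>u\<in>B. \<bar>u\<bar>)"
  define R where "R = real L * (b + 1 + T)"
  define K where "K = {- R .. R}"
  have T: "real (t i) \<le> T" if "i < M" for i
    unfolding T_def using that by (intro of_nat_mono member_le_sum) auto
  have T0: "0 \<le> T" unfolding T_def by (rule of_nat_0_le_iff)
  have b: "\<bar>real_of_int u\<bar> \<le> b" if "u \<in> B" for u
  proof -
    have "\<bar>u\<bar> \<le> (\<Sum>u\<in>B. \<bar>u\<bar>)" using that B(1) by (intro member_le_sum) auto
    then show ?thesis unfolding b_def by linarith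
  qed
  have b0: "0 \<le> b" unfolding b_def by (simp add: sum_nonneg)
  have K: "compact K" unfolding K_def by simp
  have K_inv: "ifs_map L t i ` K \<subseteq> K" if i: "i < M" for i
  proof
    fix y assume "y \<in> ifs_map L t i ` K"
    then obtain z where "z \<in> K" and y: "y = z / real L + real (t i)"
      unfolding ifs_map_def by blast
    then have z: "\<bar>z\<bar> \<le> R" by (simp add: K_def abs_le_iff)
    have zL: "\<bar>z / real L\<bar> \<le> b + 1 + T"
      using z L by (simp add: R_def abs_divide divide_le_eq mult.commute)
    have "\<bar>y\<bar> \<le> \<bar>z / real L\<bar> + real (t i)"
      unfolding y by (rule order_trans[OF abs_triangle_ineq]) simp
    also have "\<dots> \<le> 2 * (b + 1 + T)" using zL T[OF i] b0 T0 by argo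
    also have "\<dots> \<le> R" unfolding R_def using L b0 T0 by (intro mult_right_mono) auto
    finally show "y \<in> K" by (auto simp: K_def)
  qed
  have dec: "approx L M t K (Suc n) x \<subseteq> approx L M t K n x" for n x
    by (rule approx_decreasing[OF K_inv])
  define g where "g n v = measure ?P {x \<in> space ?P. real L * v \<in> approx L M t K n x}" for n v
  have g_Suc: "g (Suc n) v = 1 - (\<Prod>i<M. 1 - p * g n (real L * v - real (t i)))" for n v
    unfolding g_def using L p by (intro prob_approx_Suc K) auto
  have g_0: "g 0 v = indicator K (real L * v)" for v
    unfolding g_def by (auto simp: indicator_def P.prob_space)
  have g_meas: "g n \<in> borel_measurable borel" for n
  proof (induction n)
    case 0
    have "K \<in> sets borel" by (simp add: K_def)
    then show ?case unfolding g_0[abs_def] by measurable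
  next
    case (Suc n)
    then show ?case unfolding g_Suc[abs_def] by measurable
  qed
  interpret rec: type_recursion L M t p B g
  proof
    fix u z assume u: "u \<in> B" and z: "0 \<le> z" "z < (1::real)"
    have "\<bar>real_of_int u + z\<bar> \<le> b + 1 + T" using b[OF u] z T0 by linarith
    then have "real L * \<bar>real_of_int u + z\<bar> \<le> R" unfolding R_def by (intro mult_left_mono) auto
    then have "\<bar>real L * (real_of_int u + z)\<bar> \<le> R" by (simp add: abs_mult)
    then show "g 0 (real_of_int u + z) = 1" by (auto simp: g_0 K_def abs_le_iff)
  next
    fix n x
    show "g (Suc n) x \<le> g n x"
      unfolding g_def
      by (intro P.finite_measure_mono approx_section_sets K) (use dec[of n] in blast)
  qed (use L p B growth g_Suc g_meas in \<open>auto simp: g_def\<close>)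
  define Q where "Q = {z \<in> space (?P \<Otimes>\<^sub>M lborel). snd z \<in> (\<Inter>n. approx L M t K n (fst z))}"
  have Q: "Q \<in> sets (?P \<Otimes>\<^sub>M lborel)" unfolding Q_def by (rule Inter_approx_measurable[OF K])
  have section_meas: "(\<lambda>y. emeasure ?P ((\<lambda>x. (x, y)) -` Q)) \<in> borel_measurable borel"
    using PL.measurable_emeasure_Pair2[OF Q] by simp
  have "AE x in ?P. emeasure lborel (Pair x -` Q) = 0"
    using null
  proof (rule AE_mp, intro AE_I2 impI)
    fix x assume "x \<in> space ?P" and 0: "emeasure lborel (\<Inter>n. approx L M t I n x) = 0"
    have "Pair x -` Q \<subseteq> (\<Inter>n. approx L M t K n x)" by (auto simp: Q_def)
    also have "\<dots> \<subseteq> (\<Inter>n. approx L M t I n x)"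
      using L by (intro Inter_approx_subset I compact_imp_bounded[OF K]) auto
    finally have sub: "Pair x -` Q \<subseteq> (\<Inter>n. approx L M t I n x)" .
    have "(\<Inter>n. approx L M t I n x) \<in> sets lborel"
      using compact_approx[OF I(1)] by (simp add: borel_closed closed_INT compact_imp_closed)
    then show "emeasure lborel (Pair x -` Q) = 0"
      using emeasure_mono[OF sub] 0 by (metis le_zero_eq)
  qed
  \<comment> \<open>Null sections over outcomes make \<open>Q\<close> null; the other order of
    integration then gives null sections over almost every point \<open>y\<close>.\<close>
  then have "emeasure (?P \<Otimes>\<^sub>M lborel) Q = 0"
    unfolding lborel.emeasure_pair_measure_alt[OF Q]
    by (subst nn_integral_0_iff_AE) (auto intro: lborel.measurable_emeasure_Pair Q)
  then have "AE y in lborel. emeasure ?P ((\<lambda>x. (x, y)) -` Q) = 0"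
    unfolding PL.emeasure_pair_measure_alt2[OF Q]
    by (subst (asm) nn_integral_0_iff_AE) (simp_all add: section_meas)
  \<comment> \<open>The substitution \<open>y = L u + L z\<close> passes from points to pairs of a
    type and an environment; affine maps of nonzero slope pull null sets back to null sets.\<close>
  then have "AE z in lborel. emeasure ?P ((\<lambda>x. (x, real L * real_of_int u + real L * z)) -` Q) = 0" for u
  proof (rule AE_borel_affine[rotated 2])
    show "Measurable.pred borel (\<lambda>y. emeasure ?P ((\<lambda>x. (x, y)) -` Q) = 0)"
      using section_meas by measurable
  qed (use L in simp)
  then have "AE z in lborel. \<forall>u\<in>B. emeasure ?P ((\<lambda>x. (x, real L * (real_of_int u + z))) -` Q) = 0"
    using B(1) by (intro AE_finite_allI) (auto simp: distrib_left)
  then have AE: "AE z in unit_uniform.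
      \<forall>u\<in>B. emeasure ?P ((\<lambda>x. (x, real L * (real_of_int u + z))) -` Q) = 0"
    unfolding unit_uniform_def by (subst AE_restrict_space_iff) auto
  \<comment> \<open>Continuity from above along the decreasing approximations.\<close>
  have g_lim: "(\<lambda>n. g n v) \<longlonglongrightarrow> 0"
    if v: "emeasure ?P ((\<lambda>x. (x, real L * v)) -` Q) = 0" for v
  proof -
    let ?A = "\<lambda>n. {x \<in> space ?P. real L * v \<in> approx L M t K n x}"
    have "(\<lambda>n. measure ?P (?A n)) \<longlonglongrightarrow> measure ?P (\<Inter>n. ?A n)"
    proof (rule P.finite_Lim_measure_decseq)
      show "range ?A \<subseteq> P.events" using approx_section_sets[OF K] by blast
      show "decseq ?A"
        using dec by (intro decseq_SucI) blast
    qed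
    moreover have "(\<Inter>n. ?A n) = (\<lambda>x. (x, real L * v)) -` Q"
      by (auto simp: Q_def space_pair_measure)
    ultimately show ?thesis using v by (simp add: g_def measure_def)
  qed
  have "(\<lambda>n. \<integral>z. rec.W n z \<partial>unit_uniform) \<longlonglongrightarrow> (\<integral>z. 0 \<partial>unit_uniform)"
  proof (rule integral_dominated_convergence[where w = "\<lambda>_. real (card B)"])
    show "rec.W n \<in> borel_measurable unit_uniform" for n
      by (rule measurable_unit_uniform[OF rec.W_measurable])
    show "AE z in unit_uniform. norm (rec.W n z) \<le> real (card B)" for n
      by (simp add: rec.W_nonneg rec.W_upper)
    show "AE z in unit_uniform. (\<lambda>n. rec.W n z) \<longlonglongrightarrow> 0"
      using AE
    proof (rule AE_mp, intro AE_I2 impI)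
      fix z assume "\<forall>u\<in>B. emeasure ?P ((\<lambda>x. (x, real L * (real_of_int u + z))) -` Q) = 0"
      then show "(\<lambda>n. rec.W n z) \<longlonglongrightarrow> 0"
        unfolding rec.W_def by (intro tendsto_null_sum g_lim) auto
    qed
  qed auto
  then have lim: "(\<lambda>n. \<integral>z. rec.W n z \<partial>unit_uniform) \<longlonglongrightarrow> 0" by simp
  obtain c where c: "0 < c" "\<And>n. c \<le> (\<integral>z. rec.W n z \<partial>unit_uniform)"
    by (rule rec.integral_W_bounded_below) blast
  have "c \<le> 0" by (rule LIMSEQ_le_const[OF lim]) (use c in auto)
  with c show False by simp
qed

section \<open>From positive probability to almost sure positivity on survival\<close>

lemma survival_equation_unique:
  fixes p r s :: real
  assumes p: "0 < p" "p < 1" and r: "0 < r" "1 - r = (1 - p * r) ^ M"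
    and s: "r \<le> s" "s \<le> 1" "1 - s = (1 - p * s) ^ M"
  shows "r = s"
proof (rule ccontr)
  assume "r \<noteq> s"
  with s have rs: "r < s" by simp
  \<comment> \<open>The geometric sum divides the trivial root \<open>q = 0\<close> out of the
    equation; what remains has a left side that decreases in \<open>q\<close>.\<close>
  have sum1: "p * (\<Sum>j<M. (1 - p * q) ^ j) = 1" if q: "0 < q" "1 - q = (1 - p * q) ^ M" for q
  proof -
    have "1 - (1 - p * q) ^ M = p * q * (\<Sum>j<M. (1 - p * q) ^ j)"
      using one_diff_power_eq[of "1 - p * q" M] by simp
    then have "p * q * (\<Sum>j<M. (1 - p * q) ^ j) - q = 0"
      using q(2) by linarith
    then have "q * (p * (\<Sum>j<M. (1 - p * q) ^ j) - 1) = 0"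
      by (simp add: algebra_simps)
    then show ?thesis using q(1) by simp
  qed
  \<comment> \<open>For \<open>M = 0\<close> or \<open>M = 1\<close> the reduced equation would read
    \<open>0 = 1\<close> or \<open>p = 1\<close>. With two terms or more, the term
    \<open>j = 1\<close> makes the monotonicity strict.\<close>
  have M: "2 \<le> M"
  proof (rule ccontr)
    assume "\<not> 2 \<le> M"
    then consider "M = 0" | "M = 1" by linarith
    then show False using sum1[OF r] p by cases auto
  qed
  have ps: "p * s \<le> 1" using p r(1) s by (intro mult_le_one) auto
  have "p * r < p * s" using rs p by simp
  then have "(\<Sum>j<M. (1 - p * s) ^ j) < (\<Sum>j<M. (1 - p * r) ^ j)"
    using ps M by (intro sum_strict_mono_ex1) (auto intro!: power_mono bexI[of _ 1])
  moreover have "0 < s" using r(1) rs by simp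
  ultimately show False using sum1[OF r] sum1[OF _ s(3)] p
    by (metis less_irrefl mult_less_cancel_left_pos)
qed

text \<open>Positive measure (\<open>A\<close>) implies survival (\<open>E\<close>), and both
  probabilities solve the same branching equation. Since \<open>A\<close> is not null, uniqueness of
  the positive root makes \<open>E - A\<close> null. The measurability claim allows the statement to
  be transported along the law of the labels.\<close>

lemma AE_positive_if_non_extinct:
  assumes ifs: "integer_ifs L M t" and p: "0 < p" "p < 1"
    and not_null: "\<not> (AE x in coin_space M p. emeasure lborel (\<Inter>n. approx L M t (base_interval L M t) n x) = 0)"
  shows "{x \<in> space (coin_space M p). non_extinct M (\<lambda>w x. x w) x \<longrightarrow>
           0 < emeasure lborel (coin_tossing_set L M t (\<lambda>w x. x w) x)} \<in> sets (coin_space M p)" (is ?S)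
    and "AE x in coin_space M p. non_extinct M (\<lambda>w x. x w) x \<longrightarrow>
           0 < emeasure lborel (coin_tossing_set L M t (\<lambda>w x. x w) x)" (is ?AE)
proof -
  let ?P = "coin_space M p"
  let ?I = "base_interval L M t"
  let ?Z = "\<lambda>x. \<Inter>n. approx L M t ?I n x"
  interpret P: prob_space ?P by (rule prob_space_coin_space)
  interpret PL: pair_sigma_finite ?P lborel ..
  have L: "0 < L" using ifs by (simp add: integer_ifs_def)
  have I: "compact ?I" by (simp add: base_interval_def)
  note inv = base_interval_invariant[OF ifs]
  define A where "A = {x \<in> space ?P. 0 < emeasure lborel (?Z x)}"
  define E where "E = {x \<in> space ?P. \<forall>n. survivors M n x \<noteq> {}}"
  have A: "A \<in> sets ?P"
  proof -
    let ?Q = "{z \<in> space (?P \<Otimes>\<^sub>M lborel). snd z \<in> (\<Inter>n. approx L M t ?I n (fst z))}"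
    have [measurable]: "(\<lambda>x. emeasure lborel (Pair x -` ?Q)) \<in> borel_measurable ?P"
      by (rule lborel.measurable_emeasure_Pair[OF Inter_approx_measurable[OF I]])
    have "Pair x -` ?Q = ?Z x" if "x \<in> space ?P" for x
      using that by (auto simp: space_pair_measure)
    then have "A = {x \<in> space ?P. 0 < emeasure lborel (Pair x -` ?Q)}"
      unfolding A_def by (intro Collect_cong conj_cong) auto
    also have "\<dots> \<in> sets ?P" by measurable
    finally show ?thesis .
  qed
  have E: "E \<in> sets ?P"
  proof -
    let ?W = "\<lambda>n. {w. length w = n \<and> set w \<subseteq> {..<M}}"
    have "survivors M n x \<noteq> {} \<longleftrightarrow> (\<exists>w\<in>?W n. w \<in> survivors M n x)" for n x
    proof -
      have "survivors M n x \<subseteq> ?W n" by (auto simp: surviving_words_def)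
      then show ?thesis by blast
    qed
    then have "E = {x \<in> space ?P. \<forall>n. \<exists>w\<in>?W n. w \<in> survivors M n x}"
      unfolding E_def by (simp only:)
    also have "\<dots> \<in> sets ?P"
      by (intro sets.sets_Collect_countable_All sets.sets_Collect_finite_Ex finite_words
        predE survivors_measurable)
    finally show ?thesis .
  qed
  have sub: "subtree M i x \<in> space ?P" if "x \<in> space ?P" "i < M" for x i
    using measurable_space[OF subtree_measurable] that by blast
  have "x \<in> A \<longleftrightarrow> (\<exists>i<M. x [i] \<and> subtree M i x \<in> A)" if x: "x \<in> space ?P" for x
  proof -
    have "x \<in> A \<longleftrightarrow> 0 < emeasure lborel (?Z x)"
      unfolding A_def mem_Collect_eq using x by (simp only: simp_thms)
    also have "\<dots> \<longleftrightarrow> (\<exists>i<M. x [i] \<and> 0 < emeasure lborel (?Z (subtree M i x)))"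
      by (rule emeasure_Inter_approx_pos_iff[OF L _ I]) (rule inv)
    also have "\<dots> \<longleftrightarrow> (\<exists>i<M. x [i] \<and> subtree M i x \<in> A)"
      unfolding A_def mem_Collect_eq using sub[OF x] by meson
    finally show ?thesis .
  qed
  then have "A = {x \<in> space ?P. \<exists>i<M. x [i] \<and> subtree M i x \<in> A}"
    using sets.sets_into_space[OF A] by auto
  then have rA: "1 - P.prob A = (1 - p * P.prob A) ^ M"
    using measure_branching[of p M "\<lambda>_. A"] p A by simp
  have "x \<in> E \<longleftrightarrow> (\<exists>i<M. x [i] \<and> subtree M i x \<in> E)" if x: "x \<in> space ?P" for x
  proof -
    have "x \<in> E \<longleftrightarrow> (\<exists>i<M. x [i] \<and> (\<forall>n. survivors M n (subtree M i x) \<noteq> {}))"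
      unfolding E_def mem_Collect_eq all_survivors_iff[of M x] using x by simp
    also have "\<dots> \<longleftrightarrow> (\<exists>i<M. x [i] \<and> subtree M i x \<in> E)"
      unfolding E_def mem_Collect_eq using sub[OF x] by meson
    finally show ?thesis .
  qed
  then have "E = {x \<in> space ?P. \<exists>i<M. x [i] \<and> subtree M i x \<in> E}"
    using sets.sets_into_space[OF E] by auto
  then have rE: "1 - P.prob E = (1 - p * P.prob E) ^ M"
    using measure_branching[of p M "\<lambda>_. E"] p E by simp
  have AE: "A \<subseteq> E"
  proof
    fix x assume x: "x \<in> A"
    have "survivors M n x \<noteq> {}" for n
    proof
      assume "survivors M n x = {}"
      then have "?Z x = {}" by (auto simp: approx_def)
      with x show False by (simp add: A_def)
    qed
    with x show "x \<in> E" by (simp add: A_def E_def)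
  qed
  have "0 < P.prob A"
  proof (rule ccontr)
    assume "\<not> 0 < P.prob A"
    then have "emeasure ?P A = 0"
      using measure_nonneg[of ?P A] by (simp add: P.emeasure_eq_measure)
    then have "AE x in ?P. x \<notin> A" using A by (intro AE_not_in) auto
    then have "AE x in ?P. emeasure lborel (?Z x) = 0"
      by (rule AE_mp) (auto simp: A_def zero_less_iff_neq_zero)
    then show False using not_null by simp
  qed
  then have "P.prob A = P.prob E"
    using P.finite_measure_mono[OF AE E] by (intro survival_equation_unique[OF p _ rA _ _ rE]) auto
  then have "P.prob (E - A) = 0"
    using P.finite_measure_Diff[OF E A AE] by simp
  then have "AE x in ?P. x \<notin> E - A"
    using E A by (intro AE_not_in) (auto simp: null_sets_def P.emeasure_eq_measure)
  then show ?AE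
  proof (rule AE_mp, intro AE_I2 impI)
    fix x assume "x \<in> space ?P" "x \<notin> E - A" "non_extinct M (\<lambda>w x. x w) x"
    then have "x \<in> A" by (simp add: E_def non_extinct_iff)
    then show "0 < emeasure lborel (coin_tossing_set L M t (\<lambda>w x. x w) x)"
      by (simp add: A_def coin_tossing_set_eq[OF ifs])
  qed
  have "{x \<in> space ?P. non_extinct M (\<lambda>w x. x w) x \<longrightarrow>
           0 < emeasure lborel (coin_tossing_set L M t (\<lambda>w x. x w) x)} = (space ?P - E) \<union> A"
    by (auto simp: A_def E_def non_extinct_iff coin_tossing_set_eq[OF ifs])
  then show ?S using A E by simp
qed

text \<open>Independence and the Bernoulli marginals determine the joint law.\<close>

lemma distr_labels:
  assumes "prob_space P" and M: "1 \<le> M"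
    and indep: "prob_space.indep_vars P (\<lambda>_. count_space UNIV) X (nonempty_words M)"
    and bernoulli: "\<forall>w\<in>nonempty_words M.
          distr P (count_space UNIV) (X w) = measure_pmf (bernoulli_pmf p)"
  shows "(\<lambda>\<omega>. \<lambda>w\<in>nonempty_words M. X w \<omega>) \<in> measurable P (coin_space M p)"
    and "distr P (coin_space M p) (\<lambda>\<omega>. \<lambda>w\<in>nonempty_words M. X w \<omega>) = coin_space M p"
proof -
  interpret prob_space P by fact
  let ?Y = "\<lambda>\<omega>. \<lambda>w\<in>nonempty_words M. X w \<omega>"
  have ne: "nonempty_words M \<noteq> {}"
    using M by (auto simp: nonempty_words_def intro!: exI[of _ "[0]"])
  have rv: "random_variable (count_space UNIV) (X w)" if "w \<in> nonempty_words M" for w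
    using indep that by (auto simp: indep_vars_def)
  have sets: "sets (PiM (nonempty_words M) (\<lambda>_. count_space (UNIV :: bool set))) = sets (coin_space M p)"
    unfolding coin_space_def by (rule sets_PiM_cong) auto
  have "?Y \<in> measurable P (PiM (nonempty_words M) (\<lambda>_. count_space UNIV))"
    by (rule measurable_restrict) (rule rv)
  then show "?Y \<in> measurable P (coin_space M p)"
    using measurable_cong_sets[OF refl sets] by blast
  have "distr P (coin_space M p) ?Y = distr P (PiM (nonempty_words M) (\<lambda>_. count_space UNIV)) ?Y"
    by (rule distr_cong) (auto simp: sets)
  also have "\<dots> = PiM (nonempty_words M) (\<lambda>w. distr P (count_space UNIV) (X w))"
    using indep_vars_iff_distr_eq_PiM'[OF ne rv] indep by simp
  also have "\<dots> = coin_space M p"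
    unfolding coin_space_def by (rule PiM_cong) (auto simp: bernoulli)
  finally show "distr P (coin_space M p) ?Y = coin_space M p" .
qed

subsection \<open>Type matrices as counts of translations\<close>

lemma bij_betw_distinct_trans:
  "bij_betw (distinct_trans M t) {..<num_distinct M t} (t ` {..<M})"
  unfolding distinct_trans_def num_distinct_def by (rule bij_betw_nth) auto

lemma ifs_map_eq_iff: "ifs_map L t i = ifs_map L t' j \<longleftrightarrow> t i = t' j"
  by (auto simp: ifs_map_def fun_eq_iff)

lemma map_mult_eq: "map_mult L M t j = card {i. i < M \<and> t i = distinct_trans M t j}"
  by (simp add: map_mult_def ifs_map_eq_iff)

text \<open>Both sets are intervals of length 1, so they agree when their integer left endpoints
  do.\<close>

lemma ifs_map_basic_type_iff:
  assumes L: "0 < L"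
  shows "ifs_map L s i ` basic_type L M t k = basic_subtype L M t l a
    \<longleftrightarrow> type_position L M t k + int (s i) = type_position L M t l * int L + int a"
proof -
  let ?u = "real_of_int (type_position L M t k)"
  have "ifs_map L s i ` basic_type L M t k
      = (\<lambda>x. x / real L + real (s i)) ` {?u * real L .. (?u + 1) * real L}"
    by (simp add: ifs_map_def[abs_def] basic_type_def Let_def)
  also have "\<dots> = {?u + real (s i) .. ?u + real (s i) + 1}"
    using L by (subst image_affinity_atLeastAtMost_div) (auto simp: add_ac)
  finally have "ifs_map L s i ` basic_type L M t k = basic_subtype L M t l a
    \<longleftrightarrow> ?u + real (s i) = real_of_int (type_position L M t l) * real L + real a"
    by (auto simp: basic_subtype_def Let_def Icc_eq_Icc)
  also have "\<dots> \<longleftrightarrow> real_of_int (type_position L M t k + int (s i))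
      = real_of_int (type_position L M t l * int L + int a)" by simp
  finally show ?thesis by (simp only: of_int_eq_iff)
qed

text \<open>The enumeration of distinct maps disappears: the multiplicity of the one suitable map is
  the number of indices \<open>i\<close> with its translation.\<close>

lemma type_matrix_eq:
  assumes L: "0 < L"
  shows "type_matrix L M t a l k
    = card {i. i < M \<and> type_position L M t k + int (t i) = type_position L M t l * int L + int a}"
proof -
  let ?pk = "type_position L M t k" and ?pl = "type_position L M t l"
  define Q where "Q i \<longleftrightarrow> i < num_distinct M t \<and> ?pk + int (distinct_trans M t i) = ?pl * int L + int a" for i
  have tm: "type_matrix L M t a l k = (if \<exists>i. Q i then map_mult L M t (THE i. Q i) else 0)"
    unfolding type_matrix_def Let_def ifs_map_basic_type_iff[OF L] Q_def ..
  show ?thesis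
  proof (cases "\<exists>i. Q i")
    case True
    then obtain j where j: "Q j" by blast
    \<comment> \<open>The translation is fixed by the endpoint equation and the enumeration is
      injective, so the definite description is determined.\<close>
    have "i = j" if "Q i" for i
      using that j bij_betw_distinct_trans[of M t]
      by (auto simp: Q_def bij_betw_def inj_on_def)
    then have "(THE i. Q i) = j" using j by blast
    then have "type_matrix L M t a l k = card {i. i < M \<and> t i = distinct_trans M t j}"
      using True tm by (simp add: map_mult_eq)
    also have "{i. i < M \<and> t i = distinct_trans M t j} = {i. i < M \<and> ?pk + int (t i) = ?pl * int L + int a}"
      using j by (auto simp: Q_def)
    finally show ?thesis .
  next
    case False
    have "?pk + int (t i) \<noteq> ?pl * int L + int a" if "i < M" for i
    proof
      assume eq: "?pk + int (t i) = ?pl * int L + int a"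
      have "t i \<in> t ` {..<M}" using that by simp
      then obtain j where "j < num_distinct M t" "t i = distinct_trans M t j"
        using bij_betw_distinct_trans[of M t] unfolding bij_betw_def by auto
      with False eq show False by (auto simp: Q_def)
    qed
    then have "{i. i < M \<and> ?pk + int (t i) = ?pl * int L + int a} = {}" by auto
    then show ?thesis using False tm by (simp only: if_False card.empty)
  qed
qed

lemma bij_betw_type_position:
  "finite (basic_positions L M t) \<Longrightarrow>
    bij_betw (type_position L M t) {..<num_types L M t} (basic_positions L M t)"
  unfolding type_position_def[abs_def] num_types_def by (rule bij_betw_nth) auto

text \<open>For given \<open>i\<close> the equation determines \<open>u\<close>, so the entries of a
  column count disjoint sets of indices.\<close>

lemma column_sum_eq:
  assumes L: "0 < L" and fin: "finite (basic_positions L M t)"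
  shows "column_sum L M t a k = card {i. i < M \<and>
    (\<exists>u\<in>basic_positions L M t. type_position L M t k + int (t i) = u * int L + int a)}"
proof -
  let ?B = "basic_positions L M t" and ?v = "type_position L M t k"
  let ?S = "\<lambda>u. {i. i < M \<and> ?v + int (t i) = u * int L + int a}"
  have "column_sum L M t a k = (\<Sum>l<num_types L M t. card (?S (type_position L M t l)))"
    by (simp add: column_sum_def type_matrix_eq[OF L])
  also have "\<dots> = (\<Sum>u\<in>?B. card (?S u))"
    by (rule sum.reindex_bij_betw[OF bij_betw_type_position[OF fin]])
  also have "\<dots> = card (\<Union>u\<in>?B. ?S u)"
    using L by (intro card_UN_disjoint[symmetric] fin) auto
  also have "(\<Union>u\<in>?B. ?S u) = {i. i < M \<and> (\<exists>u\<in>?B. ?v + int (t i) = u * int L + int a)}"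
    by auto
  finally show ?thesis .
qed

theorem theorem1p11:
  fixes L M :: nat and t :: "nat \<Rightarrow> nat" and p :: real
    and P :: "'w measure" and X :: "nat list \<Rightarrow> 'w \<Rightarrow> bool"
  assumes ifs: "integer_ifs L M t"
    and p: "0 < p" "p < 1"
    and prob: "prob_space P"
    and indep: "prob_space.indep_vars P (\<lambda>_. count_space UNIV) X (nonempty_words M)"
    and bernoulli: "\<forall>w\<in>nonempty_words M.
          distr P (count_space UNIV) (X w) = measure_pmf (bernoulli_pmf p)"
    and cond1: "\<forall>U<num_types L M t. p ^ L * (\<Prod>a<L. real (column_sum L M t a U)) > 1"
    and cond2: "\<forall>b<L. \<exists>U<num_types L M t. \<forall>V<num_types L M t. type_matrix L M t b U V > 0"
  shows "AE \<omega> in P. non_extinct M X \<omega> \<longrightarrow> emeasure lborel (coin_tossing_set L M t X \<omega>) > 0"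
proof -
  have L: "2 \<le> L" and M: "1 \<le> M" using ifs by (auto simp: integer_ifs_def)
  let ?B = "basic_positions L M t" and ?I = "base_interval L M t"
  let ?Y = "\<lambda>\<omega>. \<lambda>w\<in>nonempty_words M. X w \<omega>"
  \<comment> \<open>Condition (2) at the digit 0 provides a type. As \<open>card\<close> is 0 on
    infinite sets, a positive number of types also shows that the set of positions is
    finite.\<close>
  have "0 < num_types L M t" using cond2[rule_format, of 0] L by auto
  then have B: "finite ?B" "?B \<noteq> {}" by (auto simp: num_types_def card_gt_0_iff)
  have growth: "1 < p ^ L * (\<Prod>a<L. real (card {i. i < M \<and> (\<exists>u\<in>?B. v + int (t i) = u * int L + int a)}))"
    if "v \<in> ?B" for v
  proof -
    obtain U where "U < num_types L M t" "v = type_position L M t U"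
      using \<open>v \<in> ?B\<close> bij_betw_type_position[OF B(1)] unfolding bij_betw_def by auto
    then show ?thesis using cond1 L by (simp add: column_sum_eq B(1))
  qed
  have "0 \<in> ?I" using L by (simp add: base_interval_def)
  moreover have "compact ?I" by (simp add: base_interval_def)
  ultimately have "\<not> (AE x in coin_space M p. emeasure lborel (\<Inter>n. approx L M t ?I n x) = 0)"
    using L p B growth base_interval_invariant[OF ifs] by (intro not_AE_limit_null[of _ _ ?B]) auto
  note main = AE_positive_if_non_extinct[OF ifs p this]
  note Y = distr_labels[OF prob M indep bernoulli]
  \<comment> \<open>The canonical statement is read as one about the law of the restricted labels
    and pulled back to \<open>P\<close>.\<close>
  have "AE x in distr P (coin_space M p) ?Y. non_extinct M (\<lambda>w x. x w) x \<longrightarrow>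
      0 < emeasure lborel (coin_tossing_set L M t (\<lambda>w x. x w) x)"
    unfolding Y(2) by (rule main(2))
  then have "AE \<omega> in P. non_extinct M (\<lambda>w x. x w) (?Y \<omega>) \<longrightarrow>
      0 < emeasure lborel (coin_tossing_set L M t (\<lambda>w x. x w) (?Y \<omega>))"
    by (subst (asm) AE_distr_iff[OF Y(1) main(1)])
  then show ?thesis
    unfolding non_extinct_def coin_tossing_set_def surviving_words_restrict[of M X] .
qed

end
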